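(* Let $\alpha\in(1,2]$, $\sigma>0$, $u>0$, $S>0$, $K>0$, $r\in\mathbb{R}$, $\tau>0$, let $X_t\sim L(0,\sigma^\alpha,-1)$, and put $\mu=\sigma^\alpha/\cos\frac{\pi\alpha}{2}$ and $k_u:=\log\frac{S}{K^{1/u}}+r\tau$. The value of the Log power call option, i.e. the option with payoff $\mathcal{P}^{(Log)}(S_T,K)=\left[\log\left(\frac{S_T^u}{K}\right)\right]^+$, is $$C_\alpha^{(Log)}(S,K,r,\mu,\tau)=\frac{u\,e^{-r\tau}}{\alpha}\sum_{n=0}^\infty\frac{1}{n!\,\Gamma\left(1+\frac{1-n}{\alpha}\right)}\,(k_u+\mu\tau)^n\,(-\mu\tau)^{\frac{1-n}{\alpha}}.$$
   Context: The process $X_t\sim L(0,\sigma^\alpha,-1)$ is the spectrally negative $\alpha$-stable Lévy process with characteristic function $\mathbb{E}[e^{ikX_t}]=\exp\left(-t\,\sigma^\alpha|k|^\alpha\left(1+i\tan\frac{\alpha\pi}{2}\,\mathrm{sgn}\,k\right)\right)$ for $k\in\mathbb{R}$; equivalently $\mathbb{E}[e^{pX_t}]=e^{-\mu t p^\alpha}$ for $p>0$, with $\mu=\sigma^\alpha/\cos\frac{\pi\alpha}{2}<0$. The asset price at maturity is $S_T=S\,e^{(r+\mu)\tau+X_\tau}$, where $\tau$ is the time-to-maturity, and the value of an option with payoff $\mathcal{P}(S_T,K)$ is $e^{-r\tau}\,\mathbb{E}\left[\mathcal{P}\left(Se^{(r+\mu)\tau+X_\tau},K\right)\right]$. Notation: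 $X^+:=X\mathbf{1}_{\{X>0\}}$. Conventions: $1/\Gamma(z)=0$ when $z$ is a non-positive integer, and $0^0=1$. *)

theory Defs
  imports "HOL-Probability.Probability"
begin

locale levy_process = prob_space M for M :: "'a measure" +
  fixes X :: "real \<Rightarrow> 'a \<Rightarrow> real"
  assumes random_variable_X: "\<And>t. 0 \<le> t \<Longrightarrow> random_variable borel (X t)"
    and starts_at_zero: "AE \<omega> in M. X 0 \<omega> = 0"
    and independent_increments:
      "\<And>(n::nat) t. 0 \<le> t 0 \<Longrightarrow> (\<And>i. i < n \<Longrightarrow> t i \<le> t (Suc i)) \<Longrightarrow>
        indep_vars (\<lambda>_. borel) (\<lambda>i \<omega>. X (t (Suc i)) \<omega> - X (t i) \<omega>) {..<n}"
    and stationary_increments: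
      "\<And>s t. 0 \<le> s \<Longrightarrow> 0 \<le> t \<Longrightarrow>
        distr M borel (\<lambda>\<omega>. X (s + t) \<omega> - X s \<omega>) = distr M borel (X t)"
    and stochastic_continuity:
      "\<And>s \<epsilon>. 0 \<le> s \<Longrightarrow> 0 < \<epsilon> \<Longrightarrow>
        ((\<lambda>t. prob {\<omega> \<in> space M. \<bar>X t \<omega> - X s \<omega>\<bar> > \<epsilon>}) \<longlongrightarrow> 0) (at s within {0..})"

(* The law L(0, sigma^alpha, -1): location 0, scale sigma^alpha, skewness -1.
   Meaningful for alpha in (0,2] with alpha \<noteq> 1; used below for 1 < alpha \<le> 2. *)
locale spectrally_negative_stable_process = levy_process M X
  for M :: "'a measure" and X :: "real \<Rightarrow> 'a \<Rightarrow> real" +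
  fixes \<alpha> \<sigma> :: real
  assumes char_X:
    "\<And>t k. 0 \<le> t \<Longrightarrow> char (distr M borel (X t)) k =
      exp (- complex_of_real (t * \<sigma> powr \<alpha> * \<bar>k\<bar> powr \<alpha>) *
           (1 + \<i> * complex_of_real (tan (\<alpha> * pi / 2) * sgn k)))"

definition positive_part :: "real \<Rightarrow> real" where
  "positive_part x = x * indicator {0<..} x"

definition asset_price :: "real \<Rightarrow> real \<Rightarrow> real \<Rightarrow> real \<Rightarrow> real \<Rightarrow> real" where
  "asset_price S r \<mu> \<tau> x = S * exp ((r + \<mu>) * \<tau> + x)"

(* The Bochner integral is 0 on non-integrable functions, so this is the discounted
   expected payoff only together with integrability of the payoff. *)
definition option_value ::
  "'a measure \<Rightarrow> (real \<Rightarrow> 'a \<Rightarrow> real) \<Rightarrow> (real \<Rightarrow> real \<Rightarrow> real) \<Rightarrow>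
    real \<Rightarrow> real \<Rightarrow> real \<Rightarrow> real \<Rightarrow> real \<Rightarrow> real" where
  "option_value M X P S K r \<mu> \<tau> =
    exp (- r * \<tau>) * (LINT \<omega>|M. P (asset_price S r \<mu> \<tau> (X \<tau> \<omega>)) K)"

definition log_power_call_payoff :: "real \<Rightarrow> real \<Rightarrow> real \<Rightarrow> real" where
  "log_power_call_payoff u s K = positive_part (ln (s powr u / K))"

end

theory Submission
  imports Defs
begin

text \<open>
  Put \<open>a = k\<^sub>u + \<mu> \<tau>\<close> and \<open>Y = X\<^sub>\<tau> + a\<close>; the payoff is \<open>u Y\<^sup>+\<close> and
  \<open>Y\<^sup>+ = (\<bar>Y\<bar> + Y) / 2\<close>. Here \<open>E Y = a\<close> can be read off the derivative of the characteristic
  function at \<open>0\<close>, and integrating \<open>\<pi>/2 \<bar>y\<bar> = \<integral>\<^sub>0\<^sup>\<infinity> (1 - cos (t y)) / t\<^sup>2 dt\<close> over the law of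
  \<open>Y\<close> gives \<open>E \<bar>Y\<bar> = 2/\<pi> \<integral>\<^sub>0\<^sup>\<infinity> (1 - Re (exp (i a t - w t\<^sup>\<alpha>))) / t\<^sup>2 dt\<close> with
  \<open>w = -\<mu> \<tau> exp (i \<pi> (\<alpha>/2 - 1))\<close>. Expanding \<open>exp (i a t)\<close> into its power series is justified by
  dominated convergence because \<open>\<alpha> > 1\<close>, and the terms are the Gamma integrals
  \<open>\<integral>\<^sub>0\<^sup>\<infinity> t\<^sup>n\<^sup>-\<^sup>2 exp (-w t\<^sup>\<alpha>) dt = \<Gamma>(z) w\<^sup>-\<^sup>z / \<alpha>\<close> with \<open>z = (n - 1) / \<alpha>\<close>, suitably
  regularised for \<open>n \<le> 1\<close>. The reflection formula for \<open>\<Gamma>\<close> turns them into the coefficients of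
  the pricing series.
\<close>

section \<open>Gamma integrals with a complex rate\<close>

text \<open>Restricting the measure, instead of carrying an indicator in every integrand, lets
  Fubini and dominated convergence apply directly. The point 0 is left out, so that
  almost-everywhere claims need checking only for \<open>0 < t\<close>, where \<open>powr\<close>
  and division by \<open>t\<close> behave well.\<close>

abbreviation lborel_pos :: "real measure" where
  "lborel_pos \<equiv> restrict_space lborel {0<..}"

lemma measurable_lborel_pos:
  "f \<in> borel_measurable borel \<Longrightarrow> f \<in> borel_measurable lborel_pos"
  by (intro measurable_restrict_space1) simp

lemma AE_lborel_posI: "(\<And>t. 0 < t \<Longrightarrow> P t) \<Longrightarrow> AE t in lborel_pos. P t"
  by (intro AE_I2) (simp add: space_restrict_space)

lemma sigma_finite_lborel_pos: "sigma_finite_measure lborel_pos"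
  by (rule sigma_finite_measure_restrict_space[OF lborel.sigma_finite_measure_axioms]) simp

text \<open>Joint measurability for the two exchanges of integrals below, in which \<open>N\<close>
  is \<open>lborel\<close> or a probability law on the reals.\<close>

lemma borel_measurable_pair_lborel_pos:
  assumes "sets N = sets borel" "case_prod f \<in> borel_measurable (borel \<Otimes>\<^sub>M borel)"
  shows "case_prod f \<in> borel_measurable (lborel_pos \<Otimes>\<^sub>M N)"
proof -
  have "fst \<in> (lborel_pos \<Otimes>\<^sub>M N) \<rightarrow>\<^sub>M (borel :: real measure)"
    using measurable_lborel_pos[OF measurable_ident] unfolding id_def
    by (rule measurable_compose[OF measurable_fst])
  moreover have "snd \<in> (lborel_pos \<Otimes>\<^sub>M N) \<rightarrow>\<^sub>M borel"
    using measurable_ident_sets[OF assms(1)] by (rule measurable_compose[OF measurable_snd])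
  ultimately have "(\<lambda>p. (fst p, snd p)) \<in> (lborel_pos \<Otimes>\<^sub>M N) \<rightarrow>\<^sub>M (borel \<Otimes>\<^sub>M borel)"
    by (rule measurable_Pair)
  from measurable_compose[OF this assms(2)] show ?thesis by simp
qed

lemma nn_integral_lborel_pos:
  "(\<integral>\<^sup>+t. f t \<partial>lborel_pos) = (\<integral>\<^sup>+t. f t * indicator {0<..} t \<partial>lborel)"
  by (subst nn_integral_restrict_space) auto

text \<open>Transfers a gauge integral to a Bochner integral; nonnegativity turns convergence into
  absolute integrability.\<close>

lemma has_bochner_integral_lborel_posI:
  fixes f :: "real \<Rightarrow> real"
  assumes "f \<in> borel_measurable borel" and "\<And>t. 0 < t \<Longrightarrow> 0 \<le> f t"
    and "(f has_integral I) {0<..}"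
  shows "has_bochner_integral lborel_pos f I"
proof (rule has_bochner_integral_nn_integral)
  show "0 \<le> I"
    using has_integral_nonneg[OF assms(3)] assms(2) by auto
  have "(\<integral>\<^sup>+t. f t \<partial>lborel_pos) = (\<integral>\<^sup>+t. ennreal (indicator {0<..} t * f t) \<partial>lborel)"
    unfolding nn_integral_lborel_pos by (intro nn_integral_cong) (auto split: split_indicator)
  also have "\<dots> = I"
    using nn_integral_has_integral_lebesgue[OF _ assms(3)] assms(2) by auto
  finally show "(\<integral>\<^sup>+t. f t \<partial>lborel_pos) = I" .
qed (use assms in \<open>auto intro: measurable_lborel_pos AE_lborel_posI\<close>)

section \<open>Gamma integrals with a real rate\<close>

text \<open>Substituting \<open>s = y * t powr \<alpha>\<close> reduces this to Euler's integral for
  Gamma at \<open>\<beta> / \<alpha>\<close>.\<close>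

lemma has_bochner_integral_powr_exp_powr:
  fixes \<alpha> \<beta> y :: real
  assumes "0 < \<alpha>" "0 < \<beta>" "0 < y"
  shows "has_bochner_integral lborel_pos (\<lambda>t. t powr (\<beta> - 1) * exp (- (y * t powr \<alpha>)))
           (Gamma (\<beta> / \<alpha>) * y powr - (\<beta> / \<alpha>) / \<alpha>)"
proof -
  define z where "z = \<beta> / \<alpha>"
  have z: "0 < z" "\<beta> = \<alpha> * z" using assms by (auto simp: z_def)
  define f where "f = (\<lambda>s::real. s powr (z - 1) / exp s)"
  define g where "g = (\<lambda>t::real. y * t powr \<alpha>)"
  define g' where "g' = (\<lambda>t::real. y * \<alpha> * t powr (\<alpha> - 1))"
  have g_image: "g ` {0<..} = {0<..}"
  proof (intro equalityI subsetI)
    fix s :: real assume "s \<in> {0<..}"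
    then have "s = g ((s / y) powr (1 / \<alpha>))" "(s / y) powr (1 / \<alpha>) \<in> {0<..}"
      using assms by (auto simp: g_def powr_powr)
    then show "s \<in> g ` {0<..}" by blast
  qed (use assms in \<open>auto simp: g_def\<close>)
  have inj: "inj_on g {0<..}"
  proof (rule inj_on_inverseI)
    show "(g t / y) powr (1 / \<alpha>) = t" if "t \<in> {0<..}" for t
      using that assms by (simp add: g_def powr_powr)
  qed
  have "(f has_integral Gamma z) {0..}"
    unfolding f_def by (rule Gamma_integral_real[OF z(1)])
  moreover have "(f has_integral Gamma z) {0..} \<longleftrightarrow> (f has_integral Gamma z) {0<..}"
    by (rule has_integral_spike_set_eq) (rule negligible_subset[of "{0}"]; auto)+
  ultimately have "(f has_integral Gamma z) {0<..}" by simp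
  moreover have "0 \<le> f t" for t by (simp add: f_def)
  ultimately have "f absolutely_integrable_on (g ` {0<..}) \<and> integral (g ` {0<..}) f = Gamma z"
    unfolding g_image by (auto intro!: nonnegative_absolutely_integrable_1 simp: has_integral_iff)
  then have "(\<lambda>t. \<bar>g' t\<bar> * f (g t)) absolutely_integrable_on {0<..} \<and>
      integral {0<..} (\<lambda>t. \<bar>g' t\<bar> * f (g t)) = Gamma z"
    using assms
    by (subst has_absolute_integral_change_of_variables_1'[where g = g])
       (auto simp: g_def g'_def intro!: derivative_eq_intros inj[unfolded g_def])
  then have "((\<lambda>t. \<bar>g' t\<bar> * f (g t)) has_integral Gamma z) {0<..}"
    by (auto simp: has_integral_iff intro: set_lebesgue_integral_eq_integral(1))
  \<comment> \<open>The substituted integrand is \<open>\<alpha> * y powr z\<close> times the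
    desired one, which explains this factor.\<close>
  then have "((\<lambda>t. (y powr - z / \<alpha>) * (\<bar>g' t\<bar> * f (g t))) has_integral y powr - z / \<alpha> * Gamma z) {0<..}"
    by (rule has_integral_mult_right)
  moreover have "(y powr - z / \<alpha>) * (\<bar>g' t\<bar> * f (g t)) = t powr (\<beta> - 1) * exp (- (y * t powr \<alpha>))"
    if "0 < t" for t
  proof -
    have "y powr - z * y * y powr (z - 1) = 1"
      using assms by (simp add: powr_minus powr_diff field_simps)
    moreover have "t powr (\<alpha> - 1) * (t powr \<alpha>) powr (z - 1) = t powr (\<beta> - 1)"
      unfolding powr_powr powr_add[symmetric] z(2) by (simp add: algebra_simps)
    ultimately show ?thesis using assms that
      by (simp add: f_def g_def g'_def powr_mult exp_minus field_simps)
  qed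
  ultimately have "((\<lambda>t. t powr (\<beta> - 1) * exp (- (y * t powr \<alpha>))) has_integral
      Gamma (\<beta> / \<alpha>) * y powr - (\<beta> / \<alpha>) / \<alpha>) {0<..}"
    by (subst has_integral_cong[symmetric]) (auto simp: z_def field_simps)
  then show ?thesis
    by (intro has_bochner_integral_lborel_posI) auto
qed

text \<open>With \<open>s = t powr \<alpha>\<close>, write \<open>1 - exp (- (y * s))\<close> as the
  integral of \<open>s * exp (- (v * s))\<close> over \<open>v\<close> in \<open>{0..y}\<close> and
  exchange the integrals. The \<open>t\<close>-integral is then a Gamma integral at
  \<open>z + 1 > 0\<close>, and integrating \<open>v powr (- z - 1)\<close> together with
  \<open>Gamma (z + 1) = z * Gamma z\<close> gives the value.\<close>

lemma has_bochner_integral_powr_one_minus_exp_powr: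
  fixes \<alpha> z y :: real
  assumes "0 < \<alpha>" "-1 < z" "z < 0" "0 < y"
  shows "has_bochner_integral lborel_pos (\<lambda>t. t powr (\<alpha> * z - 1) * (1 - exp (- (y * t powr \<alpha>))))
           (- Gamma z * y powr - z / \<alpha>)"
proof (rule has_bochner_integral_nn_integral)
  interpret P: sigma_finite_measure lborel_pos by (rule sigma_finite_lborel_pos)
  interpret pair_sigma_finite lborel_pos lborel ..
  have Gamma_eq: "Gamma (z + 1) = z * Gamma z"
    using assms by (intro Gamma_plus1) (auto elim!: nonpos_Ints_cases)
  \<comment> \<open>For \<open>z\<close> between -1 and 0 Gamma is negative, so the claimed value is
    nonnegative, as the passage through the nonnegative integral requires.\<close>
  have "0 < z * Gamma z" using assms Gamma_real_pos[of "z + 1"] Gamma_eq by simp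
  then have "Gamma z < 0" using assms by (simp add: zero_less_mult_iff)
  then show "0 \<le> - Gamma z * y powr - z / \<alpha>"
    using assms by (intro divide_nonneg_pos mult_nonneg_nonneg) auto
  let ?h = "\<lambda>v t. t powr (\<alpha> * z + \<alpha> - 1) * exp (- (v * t powr \<alpha>))"
  have inner: "(\<integral>\<^sup>+v. ennreal (?h v t) * indicator {0..y} v \<partial>lborel)
      = ennreal (t powr (\<alpha> * z - 1) * (1 - exp (- (y * t powr \<alpha>))))" if "0 < t" for t
  proof -
    have "(\<integral>\<^sup>+v. ennreal (?h v t) * indicator {0..y} v \<partial>lborel)
        = ennreal (- (t powr (\<alpha> * z - 1)) * exp (- (y * t powr \<alpha>))
                   - (- (t powr (\<alpha> * z - 1)) * exp (- (0 * t powr \<alpha>))))"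
    proof (rule nn_integral_FTC_Icc)
      fix v assume "v \<in> {0..y}"
      have "t powr (\<alpha> * z + \<alpha> - 1) = t powr (\<alpha> * z - 1) * t powr \<alpha>"
        by (simp add: powr_add[symmetric] algebra_simps)
      then show "((\<lambda>v. - (t powr (\<alpha> * z - 1)) * exp (- (v * t powr \<alpha>))) has_real_derivative ?h v t) (at v)"
        by (auto intro!: derivative_eq_intros)
    qed (use assms in auto)
    then show ?thesis by (simp add: algebra_simps)
  qed
  have outer: "(\<integral>\<^sup>+t. ennreal (?h v t) \<partial>lborel_pos) = ennreal (Gamma (z + 1) / \<alpha> * v powr (- z - 1))"
    if "0 < v" for v
  proof -
    have pos: "0 < \<alpha> * (z + 1)" using assms by simp
    have "has_bochner_integral lborel_pos (?h v)
       (Gamma ((\<alpha> * z + \<alpha>) / \<alpha>) * v powr - ((\<alpha> * z + \<alpha>) / \<alpha>) / \<alpha>)"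
      by (rule has_bochner_integral_powr_exp_powr) (use assms that pos in \<open>auto simp: algebra_simps\<close>)
    moreover have "(\<alpha> * z + \<alpha>) / \<alpha> = z + 1" "- (z + 1) = - z - 1"
      using assms by (simp_all add: field_simps)
    ultimately have "has_bochner_integral lborel_pos (?h v) (Gamma (z + 1) / \<alpha> * v powr (- z - 1))"
      by simp
    then show ?thesis
      by (subst nn_integral_eq_integral) (auto simp: has_bochner_integral_iff)
  qed
  have "(\<integral>\<^sup>+t. ennreal (t powr (\<alpha> * z - 1) * (1 - exp (- (y * t powr \<alpha>)))) \<partial>lborel_pos)
      = (\<integral>\<^sup>+t. \<integral>\<^sup>+v. ennreal (?h v t) * indicator {0..y} v \<partial>lborel \<partial>lborel_pos)"
    by (intro nn_integral_cong) (simp add: inner space_restrict_space)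
  also have "\<dots> = (\<integral>\<^sup>+v. \<integral>\<^sup>+t. ennreal (?h v t) * indicator {0..y} v \<partial>lborel_pos \<partial>lborel)"
    by (rule Fubini'[symmetric], rule borel_measurable_pair_lborel_pos) auto
  also have "\<dots> = (\<integral>\<^sup>+v. ennreal (Gamma (z + 1) / \<alpha> * v powr (- z - 1)) * indicator {0..y} v \<partial>lborel)"
  proof (intro nn_integral_cong_AE)
    \<comment> \<open>Only almost everywhere: at \<open>v = 0\<close> the inner integral diverges,
      whereas \<open>0 powr (- z - 1)\<close> is 0.\<close>
    show "AE v in lborel. (\<integral>\<^sup>+t. ennreal (?h v t) * indicator {0..y} v \<partial>lborel_pos)
        = ennreal (Gamma (z + 1) / \<alpha> * v powr (- z - 1)) * indicator {0..y} v"
      using AE_lborel_singleton[of 0]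
    proof eventually_elim
      case (elim v)
      then show ?case using outer[of v] by (auto split: split_indicator)
    qed
  qed
  also have "\<dots> = (\<integral>\<^sup>+v. ennreal (indicator {0..y} v * (Gamma (z + 1) / \<alpha> * v powr (- z - 1))) \<partial>lborel)"
    by (intro nn_integral_cong) (auto split: split_indicator)
  also have "\<dots> = ennreal (Gamma (z + 1) / \<alpha> * (y powr (- z - 1 + 1) / (- z - 1 + 1)))"
  proof (rule nn_integral_has_integral_lebesgue)
    show "0 \<le> Gamma (z + 1) / \<alpha> * v powr (- z - 1)" for v
      using assms Gamma_real_pos[of "z + 1"] by simp
    show "((\<lambda>v. Gamma (z + 1) / \<alpha> * v powr (- z - 1)) has_integral
        Gamma (z + 1) / \<alpha> * (y powr (- z - 1 + 1) / (- z - 1 + 1))) {0..y}"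
      by (intro has_integral_mult_right has_integral_powr_from_0) (use assms in auto)
  qed
  also have "Gamma (z + 1) / \<alpha> * (y powr (- z - 1 + 1) / (- z - 1 + 1)) = - Gamma z * y powr - z / \<alpha>"
    using assms by (simp add: Gamma_eq)
  finally show "(\<integral>\<^sup>+t. ennreal (t powr (\<alpha> * z - 1) * (1 - exp (- (y * t powr \<alpha>)))) \<partial>lborel_pos)
    = ennreal (- Gamma z * y powr - z / \<alpha>)" .
qed (use assms in \<open>auto intro!: measurable_lborel_pos AE_lborel_posI mult_nonneg_nonneg\<close>)

section \<open>From a real to a complex rate by power series\<close>

text \<open>Up to the factor \<open>Gamma (z + 1)\<close>, the numbers
  \<open>Gamma (z + Suc m) / fact m\<close> are the coefficients of the binomial series of
  \<open>(1 - q) powr - (z + 1)\<close>; the larger factorial only helps. Starting from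
  \<open>z + 1\<close> instead of \<open>z\<close> keeps the pole at \<open>z = 0\<close> out of the
  way.\<close>

lemma summable_Gamma_over_fact:
  fixes z q :: real
  assumes "-1 < z" "0 \<le> q" "q < 1"
  shows "summable (\<lambda>m. q ^ Suc m * (Gamma (z + real (Suc m)) / fact (Suc m)))"
proof -
  have z: "z + 1 \<notin> \<int>\<^sub>\<le>\<^sub>0" and pos: "0 < Gamma (z + 1)"
    using assms by (auto elim!: nonpos_Ints_cases)
  have "summable (\<lambda>m. (- (z + 1) gchoose m) * (- q) ^ m)"
    using gen_binomial_real[of "- q" "- (z + 1)"] assms by (auto simp: sums_iff)
  moreover have "(- (z + 1) gchoose m) * (- q) ^ m = q ^ m * (Gamma (z + real (Suc m)) / fact m) / Gamma (z + 1)" for m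
    using pochhammer_Gamma[OF z, of m]
    by (simp add: gbinomial_pochhammer power_minus[of q] algebra_simps)
  ultimately have "summable (\<lambda>m. q ^ m * (Gamma (z + real (Suc m)) / fact m) / Gamma (z + 1) * (q * Gamma (z + 1)))"
    by (intro summable_mult2) simp
  then have "summable (\<lambda>m. q ^ Suc m * (Gamma (z + real (Suc m)) / fact m))"
    using pos by (simp add: mult_ac)
  then show ?thesis
  proof (rule summable_comparison_test'[where N = 0])
    fix m :: nat
    have "0 < Gamma (z + real (Suc m))" using assms by (intro Gamma_real_pos) auto
    moreover have "fact m \<le> (fact (Suc m) :: real)" by (intro fact_mono) auto
    ultimately show "norm (q ^ Suc m * (Gamma (z + real (Suc m)) / fact (Suc m)))
        \<le> q ^ Suc m * (Gamma (z + real (Suc m)) / fact m)"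
      using assms
      by (auto simp del: fact_Suc power_Suc intro!: mult_left_mono divide_left_mono)
  qed
qed

lemma exp_minus_one_sums:
  fixes x :: "'a :: {real_normed_field, banach}"
  shows "(\<lambda>m. x ^ Suc m / fact (Suc m)) sums (exp x - 1)"
  using exp_converges[of x]
  by (subst sums_Suc_iff) (simp add: scaleR_conv_of_real field_simps)

text \<open>
  Expanding \<open>exp (- (w - y) t\<^sup>\<alpha>)\<close> in powers of \<open>w - y\<close> passes from a real rate \<open>y\<close> to a complex
  rate \<open>w\<close> without any rotation of contours. Subtracting the term at \<open>y\<close> leaves an integral
  converging for all \<open>z > -1\<close>.
\<close>

lemma has_bochner_integral_exp_powr_diff:
  fixes \<alpha> y z :: real and w :: complex
  assumes "0 < \<alpha>" "-1 < z" "0 < y" "norm (w - of_real y) < y"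
  shows "has_bochner_integral lborel_pos
     (\<lambda>t. of_real (t powr (\<alpha> * z - 1)) * (exp (- (w * of_real (t powr \<alpha>))) - of_real (exp (- (y * t powr \<alpha>)))))
     (of_real (y powr - z / \<alpha>) *
       (\<Sum>m. (- ((w - of_real y) / of_real y)) ^ Suc m * of_real (Gamma (z + real (Suc m)) / fact (Suc m))))"
proof -
  define g where "g m t = t powr (\<alpha> * (z + real (Suc m)) - 1) * exp (- (y * t powr \<alpha>))" for m t
  define G where "G m = y powr - z / \<alpha> * (Gamma (z + real (Suc m)) / y ^ Suc m)" for m
  define f where "f m t = (- (w - of_real y)) ^ Suc m / fact (Suc m) * of_real (g m t)" for m t
  \<comment> \<open>The factor \<open>(t powr \<alpha>) ^ Suc m\<close> from the expansion raises
    \<open>z\<close> to \<open>z + Suc m > 0\<close>, so every term is a convergent Gamma integral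
    even if \<open>z \<le> 0\<close>.\<close>
  have g: "has_bochner_integral lborel_pos (g m) (G m)" for m
  proof -
    have "0 < \<alpha> * (z + real (Suc m))" using assms by simp
    then have "has_bochner_integral lborel_pos (g m)
        (Gamma (\<alpha> * (z + real (Suc m)) / \<alpha>) * y powr - (\<alpha> * (z + real (Suc m)) / \<alpha>) / \<alpha>)"
      unfolding g_def using assms by (intro has_bochner_integral_powr_exp_powr) auto
    moreover have "y powr - (z + real (Suc m)) = y powr - z / y ^ Suc m"
      using assms powr_realpow[of y "Suc m"] by (simp only: minus_add_distrib powr_add powr_minus divide_inverse)
    ultimately show ?thesis
      using assms by (simp add: G_def mult_ac)
  qed
  have f: "has_bochner_integral lborel_pos (f m) ((- (w - of_real y)) ^ Suc m / fact (Suc m) * of_real (G m))" for m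
    unfolding f_def using g[of m]
    by (intro has_bochner_integral_mult_right has_bochner_integral_of_real)
  have norm_f: "norm (f m t) = norm (w - of_real y) ^ Suc m / fact (Suc m) * g m t" for m t
    unfolding f_def by (simp add: norm_mult norm_divide norm_power norm_minus_commute g_def del: power_Suc fact_Suc)
  have g_eq: "g m t = t powr (\<alpha> * z - 1) * exp (- (y * t powr \<alpha>)) * (t powr \<alpha>) ^ Suc m" if "0 < t" for m t
  proof -
    have "(t powr \<alpha>) ^ Suc m = t powr (\<alpha> * real (Suc m))"
      using that by (simp add: powr_powr powr_realpow[symmetric] del: power_Suc)
    then show ?thesis by (simp add: g_def powr_add[symmetric] algebra_simps)
  qed
  have "(\<lambda>m. f m t) sums (of_real (t powr (\<alpha> * z - 1)) *
      (exp (- (w * of_real (t powr \<alpha>))) - of_real (exp (- (y * t powr \<alpha>)))))" if "0 < t" for t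
  proof -
    let ?s = "complex_of_real (t powr \<alpha>)"
    have "(\<lambda>m. of_real (t powr (\<alpha> * z - 1) * exp (- (y * t powr \<alpha>))) *
         ((- (w - of_real y) * ?s) ^ Suc m / fact (Suc m)))
        sums (of_real (t powr (\<alpha> * z - 1) * exp (- (y * t powr \<alpha>))) * (exp (- (w - of_real y) * ?s) - 1))"
      by (intro sums_mult exp_minus_one_sums)
    moreover have "f m t = of_real (t powr (\<alpha> * z - 1) * exp (- (y * t powr \<alpha>))) *
         ((- (w - of_real y) * ?s) ^ Suc m / fact (Suc m))" for m
      unfolding f_def g_eq[OF that] by (simp add: power_mult_distrib del: power_Suc fact_Suc)
    moreover have "of_real (t powr (\<alpha> * z - 1) * exp (- (y * t powr \<alpha>))) * (exp (- (w - of_real y) * ?s) - 1)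
       = of_real (t powr (\<alpha> * z - 1)) * (exp (- (w * ?s)) - of_real (exp (- (y * t powr \<alpha>))))"
      by (simp add: exp_of_real[symmetric] algebra_simps exp_add[symmetric])
    ultimately show ?thesis by (simp only:)
  qed
  note f_sums = this
  have summable_f: "summable (\<lambda>m. norm (f m t))" if "0 < t" for t
  proof -
    have "summable (\<lambda>m. t powr (\<alpha> * z - 1) * exp (- (y * t powr \<alpha>)) *
        ((norm (w - of_real y) * t powr \<alpha>) ^ Suc m / fact (Suc m)))"
      by (intro summable_mult sums_summable[OF exp_minus_one_sums])
    then show ?thesis
      unfolding norm_f g_eq[OF that] by (simp add: power_mult_distrib mult_ac del: power_Suc fact_Suc)
  qed
  have "(\<integral>t. norm (f m t) \<partial>lborel_pos) = norm (w - of_real y) ^ Suc m / fact (Suc m) * G m" for m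
    unfolding norm_f
    by (intro has_bochner_integral_integral_eq has_bochner_integral_mult_right g)
  \<comment> \<open>The disc condition enters here: \<open>norm (w - of_real y) / y < 1\<close>
    makes the L1 norms of the terms summable, which permits termwise integration.\<close>
  moreover have "summable (\<lambda>m. y powr - z / \<alpha> * ((norm (w - of_real y) / y) ^ Suc m * (Gamma (z + real (Suc m)) / fact (Suc m))))"
    by (intro summable_mult summable_Gamma_over_fact) (use assms in auto)
  ultimately have "summable (\<lambda>m. \<integral>t. norm (f m t) \<partial>lborel_pos)"
    unfolding G_def by (simp add: power_divide mult_ac del: power_Suc fact_Suc)
  moreover have "AE t in lborel_pos. summable (\<lambda>m. norm (f m t))"
    by (rule AE_lborel_posI) (rule summable_f)
  moreover have "integrable lborel_pos (f m)" for m
    using f[of m] by (simp add: has_bochner_integral_iff)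
  ultimately  have "has_bochner_integral lborel_pos (\<lambda>t. \<Sum>m. f m t) (\<Sum>m. integral\<^sup>L lborel_pos (f m))"
    unfolding has_bochner_integral_iff
    by (intro conjI integrable_suminf integral_suminf)
  also have "(\<lambda>m. integral\<^sup>L lborel_pos (f m)) = (\<lambda>m. of_real (y powr - z / \<alpha>) *
        ((- ((w - of_real y) / of_real y)) ^ Suc m * of_real (Gamma (z + real (Suc m)) / fact (Suc m))))"
    unfolding has_bochner_integral_integral_eq[OF f] G_def
    by (intro ext) (simp add: minus_divide_left power_divide mult_ac del: power_Suc fact_Suc)
  also have "(\<Sum>m. of_real (y powr - z / \<alpha>) *
        ((- ((w - of_real y) / of_real y)) ^ Suc m * of_real (Gamma (z + real (Suc m)) / fact (Suc m))))
      = of_real (y powr - z / \<alpha>) *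
       (\<Sum>m. (- ((w - of_real y) / of_real y)) ^ Suc m * of_real (Gamma (z + real (Suc m)) / fact (Suc m)) :: complex)"
  proof (rule suminf_mult, rule summable_norm_cancel)
    have "0 \<le> Gamma (z + real (Suc m)) / fact (Suc m)" for m
      using assms by (intro divide_nonneg_pos less_imp_le[OF Gamma_real_pos]) auto
    moreover have "summable (\<lambda>m. norm ((w - of_real y) / of_real y) ^ Suc m * (Gamma (z + real (Suc m)) / fact (Suc m)))"
      using assms by (intro summable_Gamma_over_fact) (auto simp: norm_divide)
    ultimately show "summable (\<lambda>m. norm ((- ((w - of_real y) / of_real y)) ^ Suc m * of_real (Gamma (z + real (Suc m)) / fact (Suc m)) :: complex))"
      unfolding norm_mult norm_power norm_minus_cancel norm_of_real by (simp only: abs_of_nonneg)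
  qed
  finally show ?thesis
    by (rule has_bochner_integral_cong[THEN iffD1, rotated -1])
       (auto simp: space_restrict_space sums_unique[OF f_sums, symmetric])
qed

text \<open>With \<open>q = (w - y) / y\<close>, the series is \<open>Gamma z\<close> times the
  binomial series of \<open>(1 + q) powr - z\<close> without its constant term. The conditions on
  \<open>z\<close> exclude the poles of Gamma.\<close>

lemma has_bochner_integral_exp_powr_diff_Gamma:
  fixes \<alpha> y z :: real and w :: complex
  assumes "0 < \<alpha>" "-1 < z" "z \<noteq> 0" "0 < y" "norm (w - of_real y) < y"
  shows "has_bochner_integral lborel_pos
     (\<lambda>t. of_real (t powr (\<alpha> * z - 1)) * (exp (- (w * of_real (t powr \<alpha>))) - of_real (exp (- (y * t powr \<alpha>)))))
     (of_real (Gamma z / \<alpha>) * (w powr - of_real z - of_real (y powr - z)))"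
proof -
  define q where "q = (w - of_real y) / of_real y"
  have w: "w = of_real y * (1 + q)" using assms by (simp add: q_def field_simps)
  have q: "norm q < 1" using assms by (simp add: q_def norm_divide)
  then have "1 + q \<noteq> 0" by (metis add_eq_0_iff norm_minus_cancel norm_one less_irrefl)
  have z: "z \<notin> \<int>\<^sub>\<le>\<^sub>0" using assms by (auto elim!: nonpos_Ints_cases)
  then have "Gamma z \<noteq> 0" by (simp add: Gamma_eq_zero_iff)
  have term_eq: "of_real (Gamma z) * ((- of_real z gchoose m) * q ^ m) = (- q) ^ m * of_real (Gamma (z + real m) / fact m)" for m
  proof -
    have "(- complex_of_real z gchoose m) = of_real (- z gchoose m)"
      by (simp add: gbinomial_pochhammer pochhammer_of_real)
    also have "(- z gchoose m) = (- 1) ^ m * (Gamma (z + real m) / fact m) / Gamma z"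
      using pochhammer_Gamma[OF z, of m] by (simp add: gbinomial_pochhammer)
    finally show ?thesis using \<open>Gamma z \<noteq> 0\<close> by (simp add: power_minus[of q])
  qed
  have "(\<lambda>m. of_real (Gamma z) * ((- of_real z gchoose m) * q ^ m)) sums (of_real (Gamma z) * (1 + q) powr - of_real z)"
    by (intro sums_mult gen_binomial_complex q)
  then have "(\<lambda>m. (- q) ^ Suc m * of_real (Gamma (z + real (Suc m)) / fact (Suc m))) sums
      (of_real (Gamma z) * (1 + q) powr - of_real z - of_real (Gamma z))"
    unfolding term_eq by (subst sums_Suc_iff) simp
  \<comment> \<open>The factor \<open>y\<close> is a positive real, so the principal logarithm of
    the product splits without a multiple of 2 pi i.\<close>
  moreover have w_powr: "w powr - of_real z = of_real (y powr - z) * (1 + q) powr - of_real z"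
  proof -
    have "Ln w = of_real (ln y) + Ln (1 + q)" "w \<noteq> 0"
      using assms(4) \<open>1 + q \<noteq> 0\<close> unfolding w by (simp_all add: Ln_times_of_real Ln_of_real)
    then show ?thesis
      using assms(4) \<open>1 + q \<noteq> 0\<close>
      by (simp add: powr_def exp_of_real[symmetric] exp_add[symmetric] algebra_simps)
  qed
  ultimately have "of_real (y powr - z / \<alpha>) * (\<Sum>m. (- q) ^ Suc m * of_real (Gamma (z + real (Suc m)) / fact (Suc m)))
      = of_real (y powr - z / \<alpha>) * (of_real (Gamma z) * (1 + q) powr - of_real z - of_real (Gamma z))"
    by (simp only: sums_iff)
  also have "\<dots> = of_real (Gamma z / \<alpha>) * (of_real (y powr - z) * (1 + q) powr - of_real z - of_real (y powr - z))"
    by (simp add: divide_inverse algebra_simps)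
  also have "of_real (y powr - z) * (1 + q) powr - of_real z = w powr - of_real z"
    by (rule w_powr[symmetric])
  finally have "of_real (y powr - z / \<alpha>) * (\<Sum>m. (- q) ^ Suc m * of_real (Gamma (z + real (Suc m)) / fact (Suc m)))
      = of_real (Gamma z / \<alpha>) * (w powr - of_real z - of_real (y powr - z))" .
  with has_bochner_integral_exp_powr_diff[OF assms(1,2,4,5)] show ?thesis
    unfolding q_def by (simp only:)
qed

text \<open>The case \<open>z = 0\<close>, an integral of Frullani type: here
  \<open>Gamma (Suc m) / fact (Suc m)\<close> is \<open>1 / Suc m\<close>, and the binomial series
  gives way to that of \<open>Ln (1 + q)\<close>.\<close>

lemma has_bochner_integral_exp_powr_diff_Ln:
  fixes \<alpha> y :: real and w :: complex
  assumes "0 < \<alpha>" "0 < y" "norm (w - of_real y) < y"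
  shows "has_bochner_integral lborel_pos
     (\<lambda>t. of_real (t powr - 1) * (exp (- (w * of_real (t powr \<alpha>))) - of_real (exp (- (y * t powr \<alpha>)))))
     ((of_real (ln y) - Ln w) / of_real \<alpha>)"
proof -
  define q where "q = (w - of_real y) / of_real y"
  have w: "w = of_real y * (1 + q)" using assms by (simp add: q_def field_simps)
  have q: "norm q < 1" using assms by (simp add: q_def norm_divide)
  then have "1 + q \<noteq> 0" by (metis add_eq_0_iff norm_minus_cancel norm_one less_irrefl)
  have "(\<lambda>m. - ((- q) ^ m) / of_nat m) sums Ln (1 + q)"
    by (rule Ln_series'[OF q])
  then have "(\<lambda>m. - (- ((- q) ^ Suc m) / of_nat (Suc m))) sums - Ln (1 + q)"
    by (intro sums_minus) (subst sums_Suc_iff, simp)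
  moreover have "- (- ((- q) ^ Suc m) / of_nat (Suc m)) = (- q) ^ Suc m * of_real (Gamma (0 + real (Suc m)) / fact (Suc m))" for m
    using Gamma_fact[of m, where 'a = real] by (simp add: add_ac)
  moreover have "Ln w = of_real (ln y) + Ln (1 + q)"
    using assms \<open>1 + q \<noteq> 0\<close> unfolding w by (simp add: Ln_times_of_real Ln_of_real)
  moreover have "has_bochner_integral lborel_pos
     (\<lambda>t. of_real (t powr (\<alpha> * 0 - 1)) * (exp (- (w * of_real (t powr \<alpha>))) - of_real (exp (- (y * t powr \<alpha>)))))
     (of_real (y powr - 0 / \<alpha>) *
       (\<Sum>m. (- q) ^ Suc m * of_real (Gamma (0 + real (Suc m)) / fact (Suc m))))"
    unfolding q_def using assms by (intro has_bochner_integral_exp_powr_diff) auto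
  ultimately show ?thesis
    using assms by (simp add: sums_iff del: power_Suc fact_Suc)
qed

text \<open>For \<open>y > 0\<close> the inequality amounts to
  \<open>(norm w)\<^sup>2 < 2 * y * Re w\<close>; the witness makes \<open>y * Re w\<close> equal to
  \<open>(norm w)\<^sup>2\<close>. Hence the discs with real centre that touch 0 cover the right
  half-plane.\<close>

lemma exists_real_disc:
  fixes w :: complex
  assumes "0 < Re w"
  obtains y :: real where "0 < y" "norm (w - of_real y) < y"
proof
  define y where "y = (norm w)\<^sup>2 / Re w"
  have "w \<noteq> 0" using assms by auto
  then show "0 < y" using assms by (simp add: y_def)
  have "(norm (w - of_real y))\<^sup>2 = (norm w)\<^sup>2 - 2 * y * Re w + y\<^sup>2"
    unfolding cmod_power2 by (simp add: power2_eq_square algebra_simps)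
  also have "\<dots> < y\<^sup>2" using assms \<open>w \<noteq> 0\<close> by (simp add: y_def)
  finally show "norm (w - of_real y) < y"
    using \<open>0 < y\<close> by (simp add: power_less_imp_less_base)
qed

text \<open>Adding the integral with real rate \<open>y\<close> to the difference formula cancels
  every term in the auxiliary \<open>y\<close>.\<close>

lemma has_bochner_integral_powr_exp_powr_complex:
  fixes \<alpha> z :: real and w :: complex
  assumes "0 < \<alpha>" "0 < z" "0 < Re w"
  shows "has_bochner_integral lborel_pos (\<lambda>t. of_real (t powr (\<alpha> * z - 1)) * exp (- (w * of_real (t powr \<alpha>))))
     (of_real (Gamma z / \<alpha>) * w powr - of_real z)"
proof -
  obtain y where y: "0 < y" "norm (w - of_real y) < y" by (rule exists_real_disc[OF assms(3)])
  have "has_bochner_integral lborel_pos (\<lambda>t. complex_of_real (t powr (\<alpha> * z - 1) * exp (- (y * t powr \<alpha>))))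
      (of_real (Gamma z * y powr - z / \<alpha>))"
    using has_bochner_integral_powr_exp_powr[of \<alpha> "\<alpha> * z" y] assms y
    by (intro has_bochner_integral_of_real) simp
  moreover have "has_bochner_integral lborel_pos
     (\<lambda>t. of_real (t powr (\<alpha> * z - 1)) * (exp (- (w * of_real (t powr \<alpha>))) - of_real (exp (- (y * t powr \<alpha>)))))
     (of_real (Gamma z / \<alpha>) * (w powr - of_real z - of_real (y powr - z)))"
    using assms y by (intro has_bochner_integral_exp_powr_diff_Gamma) auto
  ultimately have "has_bochner_integral lborel_pos
     (\<lambda>t. of_real (t powr (\<alpha> * z - 1) * exp (- (y * t powr \<alpha>))) +
       of_real (t powr (\<alpha> * z - 1)) * (exp (- (w * of_real (t powr \<alpha>))) - of_real (exp (- (y * t powr \<alpha>)))))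
     (of_real (Gamma z * y powr - z / \<alpha>) + of_real (Gamma z / \<alpha>) * (w powr - of_real z - of_real (y powr - z)))"
    by (rule has_bochner_integral_add)
  then show ?thesis
    by (simp add: right_diff_distrib)
qed

text \<open>The same cancellation, with the difference formula subtracted from the regularised
  integral with real rate \<open>y\<close>.\<close>

lemma has_bochner_integral_powr_one_minus_exp_powr_complex:
  fixes \<alpha> z :: real and w :: complex
  assumes "0 < \<alpha>" "-1 < z" "z < 0" "0 < Re w"
  shows "has_bochner_integral lborel_pos (\<lambda>t. of_real (t powr (\<alpha> * z - 1)) * (1 - exp (- (w * of_real (t powr \<alpha>)))))
     (- (of_real (Gamma z / \<alpha>) * w powr - of_real z))"
proof -
  obtain y where y: "0 < y" "norm (w - of_real y) < y" by (rule exists_real_disc[OF assms(4)])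
  have "has_bochner_integral lborel_pos (\<lambda>t. complex_of_real (t powr (\<alpha> * z - 1) * (1 - exp (- (y * t powr \<alpha>)))))
      (of_real (- Gamma z * y powr - z / \<alpha>))"
    using has_bochner_integral_powr_one_minus_exp_powr[of \<alpha> z y] assms y
    by (intro has_bochner_integral_of_real) simp
  moreover have "has_bochner_integral lborel_pos
     (\<lambda>t. of_real (t powr (\<alpha> * z - 1)) * (exp (- (w * of_real (t powr \<alpha>))) - of_real (exp (- (y * t powr \<alpha>)))))
     (of_real (Gamma z / \<alpha>) * (w powr - of_real z - of_real (y powr - z)))"
    using assms y by (intro has_bochner_integral_exp_powr_diff_Gamma) auto
  ultimately have "has_bochner_integral lborel_pos
     (\<lambda>t. of_real (t powr (\<alpha> * z - 1) * (1 - exp (- (y * t powr \<alpha>)))) -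
       of_real (t powr (\<alpha> * z - 1)) * (exp (- (w * of_real (t powr \<alpha>))) - of_real (exp (- (y * t powr \<alpha>)))))
     (of_real (- Gamma z * y powr - z / \<alpha>) - of_real (Gamma z / \<alpha>) * (w powr - of_real z - of_real (y powr - z)))"
    by (rule has_bochner_integral_diff)
  then show ?thesis
    by (simp add: right_diff_distrib)
qed

text \<open>Both the subtracted exponential and \<open>ln y\<close> are real, so taking imaginary
  parts removes the regularisation.\<close>

lemma has_bochner_integral_Im_exp_powr:
  fixes \<alpha> :: real and w :: complex
  assumes "0 < \<alpha>" "0 < Re w"
  shows "has_bochner_integral lborel_pos (\<lambda>t. t powr - 1 * Im (exp (- (w * of_real (t powr \<alpha>))))) (- (Im (Ln w) / \<alpha>))"
proof -
  obtain y where y: "0 < y" "norm (w - of_real y) < y" by (rule exists_real_disc[OF assms(2)])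
  show ?thesis
    using has_bochner_integral_bounded_linear[OF bounded_linear_Im
      has_bochner_integral_exp_powr_diff_Ln[OF assms(1) y]]
    by (simp add: Im_divide_of_real)
qed

section \<open>First absolute moment from the characteristic function\<close>

lemma has_bochner_integral_lborel_pos_iff:
  fixes f :: "real \<Rightarrow> real"
  shows "has_bochner_integral lborel_pos f I \<longleftrightarrow> has_bochner_integral lborel (\<lambda>t. indicator {0<..} t *\<^sub>R f t) I"
  by (rule has_bochner_integral_restrict_space) simp

section \<open>Fourier representation of the absolute value\<close>

text \<open>Integration by parts suggests the antiderivative \<open>Si t - (1 - cos t) / t\<close>,
  with limits 0 at 0 and \<open>pi / 2\<close> at infinity. As the integrand is nonnegative, the
  fundamental theorem on the unbounded interval also gives integrability.\<close>

lemma has_bochner_integral_one_minus_cos: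
  "has_bochner_integral lborel_pos (\<lambda>t::real. (1 - cos t) / t\<^sup>2) (pi / 2)"
proof -
  define F where "F t = Si t - (1 - cos t) / t" for t
  have lim0: "(F \<longlongrightarrow> 0) (at_right 0)"
  proof -
    have "((\<lambda>h. (cos (0 + h) - cos 0) / h) \<longlongrightarrow> - sin 0) (at (0::real))"
      using DERIV_cos[of "0::real"] by (simp add: DERIV_def)
    then have "((\<lambda>h. (cos h - 1) / h) \<longlongrightarrow> 0) (at (0::real))"
      by simp
    then have "((\<lambda>h. (cos h - 1) / h) \<longlongrightarrow> 0) (at_right (0::real))"
      by (rule tendsto_mono[OF at_le[OF subset_UNIV]])
    moreover have "Si 0 = 0"
      by (simp add: Si_def zero_ereal_def)
    then have "(Si \<longlongrightarrow> 0) (at 0)"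
      using isCont_Si[of 0] by (simp add: isCont_def)
    then have "(Si \<longlongrightarrow> 0) (at_right 0)"
      by (rule tendsto_mono[OF at_le[OF subset_UNIV]])
    ultimately have "((\<lambda>h. Si h + (cos h - 1) / h) \<longlongrightarrow> 0 + 0) (at_right 0)"
      by (intro tendsto_add)
    then show ?thesis by (simp add: F_def[abs_def] diff_divide_distrib algebra_simps)
  qed
  have lim_top: "(F \<longlongrightarrow> pi / 2) at_top"
  proof -
    have "((\<lambda>t::real. (1 - cos t) / t) \<longlongrightarrow> 0) at_top"
    proof (rule Lim_null_comparison)
      show "\<forall>\<^sub>F t in at_top. norm ((1 - cos t) / t) \<le> 2 / t"
        using eventually_gt_at_top[of 0]
      proof eventually_elim
        case (elim t)
        have "\<bar>1 - cos t\<bar> \<le> 2" using cos_le_one[of t] cos_ge_minus_one[of t] by linarith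
        then show ?case using elim by (simp add: divide_right_mono)
      qed
      show "((\<lambda>t::real. 2 / t) \<longlongrightarrow> 0) at_top"
        by (intro tendsto_divide_0[OF tendsto_const] filterlim_at_top_imp_at_infinity filterlim_ident)
    qed
    then have "(F \<longlongrightarrow> pi / 2 - 0) at_top"
      unfolding F_def by (intro tendsto_diff Si_at_top)
    then show ?thesis by simp
  qed
  have deriv: "(F has_real_derivative (1 - cos t) / t\<^sup>2) (at t)"
    and cont: "isCont (\<lambda>t. (1 - cos t) / t\<^sup>2) t" if "0 < ereal t" for t
  proof -
    from that have "t \<noteq> 0" by auto
    then show "isCont (\<lambda>t. (1 - cos t) / t\<^sup>2) t"
      by (intro continuous_intros) auto
    have "(F has_real_derivative sinc t - (sin t * t - (1 - cos t) * 1) / (t * t)) (at t)"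
      unfolding F_def using \<open>t \<noteq> 0\<close>
      by (auto intro!: derivative_eq_intros DERIV_Si)
    moreover have "sinc t - (sin t * t - (1 - cos t) * 1) / (t * t) = (1 - cos t) / t\<^sup>2"
      using \<open>t \<noteq> 0\<close> by (simp add: field_simps power2_eq_square)
    ultimately show "(F has_real_derivative (1 - cos t) / t\<^sup>2) (at t)" by simp
  qed
  have nonneg: "AE t in lborel. 0 < ereal t \<longrightarrow> ereal t < \<infinity> \<longrightarrow> 0 \<le> (1 - cos t) / t\<^sup>2"
    by simp
  have A: "((F \<circ> real_of_ereal) \<longlongrightarrow> 0) (at_right 0)"
    using lim0 by (simp add: zero_ereal_def ereal_tendsto_simps)
  have B: "((F \<circ> real_of_ereal) \<longlongrightarrow> pi / 2) (at_left \<infinity>)"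
    using lim_top by (simp add: ereal_tendsto_simps)
  have "set_integrable lborel (einterval 0 \<infinity>) (\<lambda>t. (1 - cos t) / t\<^sup>2)"
    "(LBINT t=0..\<infinity>. (1 - cos t) / t\<^sup>2) = pi / 2 - 0"
    using interval_integral_FTC_nonneg[OF _ deriv cont nonneg A B] by simp_all
  moreover have "einterval 0 \<infinity> = {0<..}"
    by (auto simp: einterval_def zero_ereal_def)
  ultimately show ?thesis
    unfolding has_bochner_integral_lborel_pos_iff
    by (simp add: has_bochner_integral_iff set_integrable_def interval_lebesgue_integral_0_infty
      set_lebesgue_integral_def)
qed

text \<open>Rescaling by \<open>\<bar>x\<bar>\<close>, with \<open>cos\<close> even. This writes
  \<open>\<bar>x\<bar>\<close> through \<open>1 - cos (t * x)\<close>, whose expectation is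
  \<open>1 - Re (char M t)\<close>.\<close>

lemma has_bochner_integral_one_minus_cos_scaled:
  fixes x :: real
  shows "has_bochner_integral lborel_pos (\<lambda>t. (1 - cos (t * x)) / t\<^sup>2) (pi / 2 * \<bar>x\<bar>)"
proof (cases "x = 0")
  case False
  have "has_bochner_integral lborel
      (\<lambda>t. indicator {0<..} (0 + \<bar>x\<bar> * t) *\<^sub>R ((1 - cos (0 + \<bar>x\<bar> * t)) / (0 + \<bar>x\<bar> * t)\<^sup>2)) ((pi / 2) /\<^sub>R \<bar>\<bar>x\<bar>\<bar>)"
    using has_bochner_integral_one_minus_cos False
    unfolding has_bochner_integral_lborel_pos_iff
    by (subst lborel_has_bochner_integral_real_affine_iff[symmetric, of "\<bar>x\<bar>"]) auto
  then have "has_bochner_integral lborel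
      (\<lambda>t. x\<^sup>2 * (indicator {0<..} (0 + \<bar>x\<bar> * t) *\<^sub>R ((1 - cos (0 + \<bar>x\<bar> * t)) / (0 + \<bar>x\<bar> * t)\<^sup>2)))
      (x\<^sup>2 * ((pi / 2) /\<^sub>R \<bar>\<bar>x\<bar>\<bar>))"
    by (rule has_bochner_integral_mult_right)
  moreover have "cos (\<bar>x\<bar> * t) = cos (t * x)" for t
    by (cases "0 \<le> x") (auto simp: mult.commute)
  ultimately have "has_bochner_integral lborel
      (\<lambda>t. indicator {0<..} t *\<^sub>R ((1 - cos (t * x)) / t\<^sup>2)) (x\<^sup>2 * ((pi / 2) /\<^sub>R \<bar>x\<bar>))"
    using False by (simp add: indicator_def zero_less_mult_iff power_mult_distrib if_distrib cong: if_cong)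
  moreover have "x\<^sup>2 * ((pi / 2) /\<^sub>R \<bar>x\<bar>) = pi / 2 * \<bar>x\<bar>"
    using False by (cases "0 < x") (auto simp: power2_eq_square field_simps)
  ultimately show ?thesis
    unfolding has_bochner_integral_lborel_pos_iff by (simp only:)
qed (simp add: has_bochner_integral_zero)

section \<open>Moments of a law from its characteristic function\<close>

lemma (in real_distribution) Re_char:
  "Re (char M t) = expectation (\<lambda>x. cos (t * x))"
proof -
  have "integrable M (\<lambda>x. iexp (t * x))"
    using integrable_iexp[of "\<lambda>x. complex_of_real (t * x)"] by simp
  from integral_Re[OF this] show ?thesis
    by (simp add: char_def Re_exp)
qed

text \<open>Everything is nonnegative, so the integrals over \<open>t\<close> and \<open>x\<close>
  can be exchanged with no prior moment condition: the finite first absolute moment is a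
  conclusion.\<close>

lemma (in real_distribution) has_bochner_integral_abs_char:
  assumes "has_bochner_integral lborel_pos (\<lambda>t. (1 - Re (char M t)) / t\<^sup>2) V"
  shows "has_bochner_integral M (\<lambda>x. \<bar>x\<bar>) (2 / pi * V)"
proof (rule has_bochner_integral_nn_integral)
  interpret P: sigma_finite_measure lborel_pos by (rule sigma_finite_lborel_pos)
  interpret pair_sigma_finite lborel_pos M ..
  have Re_char_le: "Re (char M t) \<le> 1" for t
    using complex_Re_le_cmod[of "char M t"] cmod_char_le_1[of t] by linarith
  have V: "0 \<le> V" "(\<integral>\<^sup>+t. (1 - Re (char M t)) / t\<^sup>2 \<partial>lborel_pos) = V"
  proof -
    have "0 \<le> integral\<^sup>L lborel_pos (\<lambda>t. (1 - Re (char M t)) / t\<^sup>2)"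
      using Re_char_le by (intro integral_nonneg_AE AE_I2) auto
    then show "0 \<le> V" using assms by (simp add: has_bochner_integral_iff)
    show "(\<integral>\<^sup>+t. (1 - Re (char M t)) / t\<^sup>2 \<partial>lborel_pos) = V"
      using assms Re_char_le by (subst nn_integral_eq_integral) (auto simp: has_bochner_integral_iff)
  qed
  then show "0 \<le> 2 / pi * V" by simp
  have kernel: "(\<integral>\<^sup>+t. (1 - cos (t * x)) / t\<^sup>2 \<partial>lborel_pos) = pi / 2 * \<bar>x\<bar>" for x
    using has_bochner_integral_one_minus_cos_scaled[of x]
    by (subst nn_integral_eq_integral) (auto simp: has_bochner_integral_iff)
  have inner: "(\<integral>\<^sup>+x. (1 - cos (t * x)) / t\<^sup>2 \<partial>M) = (1 - Re (char M t)) / t\<^sup>2" for t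
  proof -
    have "integrable M (\<lambda>x. cos (t * x))"
      by (rule integrable_const_bound[where B = 1]) auto
    then show ?thesis
      unfolding Re_char by (subst nn_integral_eq_integral) (auto simp: prob_space simp del: space_eq_univ)
  qed
  have "ennreal (2 / pi) * ennreal V = ennreal (2 / pi) * (\<integral>\<^sup>+t. \<integral>\<^sup>+x. (1 - cos (t * x)) / t\<^sup>2 \<partial>M \<partial>lborel_pos)"
    by (simp add: inner V)
  also have "(\<integral>\<^sup>+t. \<integral>\<^sup>+x. (1 - cos (t * x)) / t\<^sup>2 \<partial>M \<partial>lborel_pos) = (\<integral>\<^sup>+x. \<integral>\<^sup>+t. (1 - cos (t * x)) / t\<^sup>2 \<partial>lborel_pos \<partial>M)"
    by (rule Fubini'[symmetric], rule borel_measurable_pair_lborel_pos) auto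
  also have "ennreal (2 / pi) * (\<integral>\<^sup>+x. \<integral>\<^sup>+t. (1 - cos (t * x)) / t\<^sup>2 \<partial>lborel_pos \<partial>M) = (\<integral>\<^sup>+x. ennreal (2 / pi) * ennreal (pi / 2 * \<bar>x\<bar>) \<partial>M)"
    unfolding kernel by (rule nn_integral_cmult[symmetric]) auto
  also have "\<dots> = (\<integral>\<^sup>+x. \<bar>x\<bar> \<partial>M)"
    by (intro nn_integral_cong) (subst ennreal_mult[symmetric], auto)
  finally have "ennreal (2 / pi) * ennreal V = (\<integral>\<^sup>+x. \<bar>x\<bar> \<partial>M)" .
  moreover have "ennreal (2 / pi * V) = ennreal (2 / pi) * ennreal V"
    using V(1) by (intro ennreal_mult) auto
  ultimately show "(\<integral>\<^sup>+x. \<bar>x\<bar> \<partial>M) = ennreal (2 / pi * V)"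
    by (simp only:)
qed auto

text \<open>Differentiation under the expectation at 0, dominated by \<open>\<bar>x\<bar>\<close>
  through \<open>norm (iexp y - 1) \<le> \<bar>y\<bar>\<close>. A sequence of increments fits
  dominated convergence and suffices to identify the mean.\<close>

lemma (in real_distribution) char_difference_quotient_tendsto:
  assumes "integrable M (\<lambda>x. x)"
  shows "(\<lambda>n. (char M (1 / real (Suc n)) - 1) * real (Suc n)) \<longlonglongrightarrow> \<i> * expectation (\<lambda>x. x)"
proof -
  define s where "s n x = (iexp (1 / real (Suc n) * x) - 1) * real (Suc n)" for n x
  have "(\<lambda>n. integral\<^sup>L M (s n)) \<longlonglongrightarrow> (\<integral>x. \<i> * complex_of_real x \<partial>M)"
  proof (rule integral_dominated_convergence[where w = "\<lambda>x. \<bar>x\<bar>"])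
    show "AE x in M. norm (s n x) \<le> \<bar>x\<bar>" for n
    proof (rule AE_I2)
      fix x
      have "norm (iexp (1 / real (Suc n) * x) - 1) \<le> \<bar>1 / real (Suc n) * x\<bar>"
        using iexp_approx1[of "1 / real (Suc n) * x" 0] by simp
      moreover have "norm (s n x) = norm (iexp (1 / real (Suc n) * x) - 1) * real (Suc n)"
        unfolding s_def norm_mult norm_of_real by simp
      ultimately show "norm (s n x) \<le> \<bar>x\<bar>"
        by (simp add: abs_mult field_simps del: of_nat_Suc)
    qed
    show "AE x in M. (\<lambda>n. s n x) \<longlonglongrightarrow> \<i> * complex_of_real x"
    proof (rule AE_I2)
      fix x
      have "((\<lambda>h. exp (\<i> * (h * of_real x))) has_field_derivative \<i> * of_real x) (at (0 :: complex))"
        by (auto intro!: derivative_eq_intros)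
      then have "((\<lambda>h. (exp (\<i> * (h * of_real x)) - 1) / h) \<longlongrightarrow> \<i> * of_real x) (at (0 :: complex))"
        by (simp add: DERIV_def)
      moreover have "filterlim (\<lambda>n. complex_of_real (1 / real (Suc n))) (at 0) sequentially"
        using tendsto_of_real[OF LIMSEQ_Suc[OF lim_1_over_n], where 'a = complex]
        by (auto simp: filterlim_at simp del: of_nat_Suc)
      ultimately have "(\<lambda>n. (exp (\<i> * (complex_of_real (1 / real (Suc n)) * of_real x)) - 1) / complex_of_real (1 / real (Suc n)))
          \<longlonglongrightarrow> \<i> * of_real x"
        by (rule filterlim_compose)
      then show "(\<lambda>n. s n x) \<longlonglongrightarrow> \<i> * complex_of_real x"
        by (simp add: s_def field_simps del: of_nat_Suc)
    qed
  qed (use assms in \<open>auto simp: s_def[abs_def]\<close>)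
  moreover have "integral\<^sup>L M (s n) = (char M (1 / real (Suc n)) - 1) * real (Suc n)" for n
  proof -
    have "integrable M (\<lambda>x. iexp (1 / real (Suc n) * x))"
      using integrable_iexp[of "\<lambda>x. complex_of_real (1 / real (Suc n) * x)"] by simp
    then show ?thesis
      unfolding s_def char_def by (simp add: prob_space del: of_nat_Suc space_eq_univ)
  qed
  ultimately show ?thesis by simp
qed

section \<open>Power series in the shift\<close>

text \<open>Beyond the solution of \<open>b = A * t powr (\<alpha> - 1)\<close> the power dominates,
  because \<open>\<alpha> > 1\<close>; up to it, \<open>b * t\<close> is bounded by its value there,
  which is the witness for \<open>K\<close>.\<close>

lemma linear_le_powr:
  fixes A \<alpha> b :: real
  assumes "0 < A" "1 < \<alpha>" "0 \<le> b"
  shows "\<exists>K. \<forall>t>0. b * t \<le> K + A * t powr \<alpha>"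
proof (intro exI allI impI)
  fix t :: real assume "0 < t"
  show "b * t \<le> b * (b / A) powr (1 / (\<alpha> - 1)) + A * t powr \<alpha>"
  proof (cases "b \<le> A * t powr (\<alpha> - 1)")
    case True
    then have "b * t \<le> A * t powr (\<alpha> - 1) * t" using \<open>0 < t\<close> by simp
    also have "\<dots> = A * t powr \<alpha>" using \<open>0 < t\<close> by (simp add: powr_diff)
    also have "\<dots> \<le> b * (b / A) powr (1 / (\<alpha> - 1)) + A * t powr \<alpha>" using assms by simp
    finally show ?thesis .
  next
    case False
    then have "t powr (\<alpha> - 1) \<le> b / A" using assms by (simp add: field_simps)
    then have "(t powr (\<alpha> - 1)) powr (1 / (\<alpha> - 1)) \<le> (b / A) powr (1 / (\<alpha> - 1))"
      using assms by (intro powr_mono2) auto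
    then have "t \<le> (b / A) powr (1 / (\<alpha> - 1))"
      using assms \<open>0 < t\<close> by (simp add: powr_powr)
    then have "b * t \<le> b * (b / A) powr (1 / (\<alpha> - 1))" using assms by (intro mult_left_mono) auto
    also have "\<dots> \<le> b * (b / A) powr (1 / (\<alpha> - 1)) + A * t powr \<alpha>" using assms by simp
    finally show ?thesis .
  qed
qed

lemma integrable_exp_linear_minus_powr:
  fixes A \<alpha> b :: real
  assumes "0 < A" "1 < \<alpha>" "0 \<le> b"
  shows "integrable lborel_pos (\<lambda>t. exp (b * t - A * t powr \<alpha>))"
proof -
  \<comment> \<open>Half of \<open>A\<close> absorbs the linear term; the other half leaves a
    convergent Gamma integral with \<open>\<beta> = 1\<close>.\<close>
  obtain K where K: "\<And>t. 0 < t \<Longrightarrow> b * t \<le> K + A / 2 * t powr \<alpha>"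
    using linear_le_powr[of "A / 2" \<alpha> b] assms by auto
  have "integrable lborel_pos (\<lambda>t. exp K * (t powr (1 - 1) * exp (- (A / 2 * t powr \<alpha>))))"
    using has_bochner_integral_powr_exp_powr[of \<alpha> 1 "A / 2"] assms
    by (intro integrable_mult_right) (auto simp: has_bochner_integral_iff)
  then show ?thesis
  proof (rule Bochner_Integration.integrable_bound)
    show "AE t in lborel_pos. norm (exp (b * t - A * t powr \<alpha>)) \<le> norm (exp K * (t powr (1 - 1) * exp (- (A / 2 * t powr \<alpha>))))"
    proof (rule AE_lborel_posI)
      fix t :: real assume "0 < t"
      then show "norm (exp (b * t - A * t powr \<alpha>)) \<le> norm (exp K * (t powr (1 - 1) * exp (- (A / 2 * t powr \<alpha>))))"
        using K[of t] by (simp add: exp_add[symmetric])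
    qed
  qed (auto intro: measurable_lborel_pos)
qed

text \<open>
  The term of order \<open>n\<close> in \<open>a\<close> of \<open>(1 - Re (exp (i a t - w t\<^sup>\<alpha>))) / t\<^sup>2\<close>. The constant \<open>1\<close> goes
  into the term \<open>n = 0\<close>, which would not be integrable at \<open>0\<close> otherwise.
\<close>

definition fourier_term :: "real \<Rightarrow> complex \<Rightarrow> real \<Rightarrow> nat \<Rightarrow> real \<Rightarrow> real" where
  "fourier_term \<alpha> w a n t = (if n = 0 then 1 / t\<^sup>2 else 0) -
     Re ((\<i> * of_real a) ^ n / fact n * (of_real (t powr (real n - 2)) * exp (- (w * of_real (t powr \<alpha>)))))"

text \<open>At \<open>n = 1\<close> the general formula would evaluate Gamma at its pole 0, so the
  logarithmic integral supplies that coefficient.\<close>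

definition fourier_coeff :: "real \<Rightarrow> complex \<Rightarrow> real \<Rightarrow> nat \<Rightarrow> real" where
  "fourier_coeff \<alpha> w a n = (if n = 1 then - (a * Im (Ln w) / \<alpha>) else
     - Re ((\<i> * of_real a) ^ n / fact n * (of_real (Gamma ((real n - 1) / \<alpha>) / \<alpha>) * w powr - of_real ((real n - 1) / \<alpha>))))"

text \<open>The exponent is \<open>z = (n - 1) / \<alpha>\<close>. For \<open>n = 0\<close> it lies
  between -1 and 0, thanks to \<open>\<alpha> > 1\<close>, and the regularised integral applies; for
  \<open>n = 1\<close> the factor \<open>\<i>\<close> leaves only the imaginary part; for larger
  \<open>n\<close> it is positive.\<close>

lemma has_bochner_integral_fourier_term:
  assumes "0 < Re w" "1 < \<alpha>"
  shows "has_bochner_integral lborel_pos (fourier_term \<alpha> w a n) (fourier_coeff \<alpha> w a n)"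
proof -
  consider "n = 0" | "n = 1" | "2 \<le> n" by linarith
  then show ?thesis
  proof cases
    case 1
    have *: "\<alpha> * (- 1 / \<alpha>) - 1 = - 2" using assms by simp
    have "has_bochner_integral lborel_pos
       (\<lambda>t. Re (of_real (t powr (\<alpha> * (- 1 / \<alpha>) - 1)) * (1 - exp (- (w * of_real (t powr \<alpha>))))))
       (Re (- (of_real (Gamma (- 1 / \<alpha>) / \<alpha>) * w powr - of_real (- 1 / \<alpha>))))"
      using assms
      by (intro has_bochner_integral_bounded_linear[OF bounded_linear_Re]
          has_bochner_integral_powr_one_minus_exp_powr_complex) auto
    then have "has_bochner_integral lborel_pos
       (\<lambda>t. Re (of_real (t powr - 2) * (1 - exp (- (w * of_real (t powr \<alpha>))))))
       (fourier_coeff \<alpha> w a n)"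
      unfolding * by (simp add: 1 fourier_coeff_def)
    moreover have "Re (of_real (t powr - 2) * (1 - exp (- (w * of_real (t powr \<alpha>))))) = fourier_term \<alpha> w a n t"
      if "0 < t" for t
      using that by (simp add: fourier_term_def 1 powr_minus powr_numeral algebra_simps inverse_eq_divide)
    ultimately show ?thesis
      by (subst has_bochner_integral_cong[symmetric, OF refl _ refl]) (auto simp: space_restrict_space)
  next
    case 2
    have "has_bochner_integral lborel_pos (\<lambda>t. a * (t powr - 1 * Im (exp (- (w * of_real (t powr \<alpha>))))))
        (a * - (Im (Ln w) / \<alpha>))"
      by (intro has_bochner_integral_mult_right has_bochner_integral_Im_exp_powr) (use assms in auto)
    then show ?thesis
      by (simp add: 2 fourier_term_def[abs_def] fourier_coeff_def)
  next
    case 3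
    have "has_bochner_integral lborel_pos
      (\<lambda>t. - Re ((\<i> * of_real a) ^ n / fact n *
          (of_real (t powr (\<alpha> * ((real n - 1) / \<alpha>) - 1)) * exp (- (w * of_real (t powr \<alpha>))))))
      (- Re ((\<i> * of_real a) ^ n / fact n *
          (of_real (Gamma ((real n - 1) / \<alpha>) / \<alpha>) * w powr - of_real ((real n - 1) / \<alpha>))))"
      using assms 3
      by (intro has_bochner_integral_minus has_bochner_integral_bounded_linear[OF bounded_linear_Re]
          has_bochner_integral_mult_right has_bochner_integral_powr_exp_powr_complex) auto
    moreover have "\<alpha> * ((real n - 1) / \<alpha>) - 1 = real n - 2" using assms by simp
    ultimately show ?thesis
      using 3 by (simp only: fourier_term_def[abs_def] fourier_coeff_def) simp
  qed
qed

section \<open>Termwise integration of the expansion\<close>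

lemma fourier_term_sums:
  assumes "0 < t"
  shows "(\<lambda>n. fourier_term \<alpha> w a n t) sums
    ((1 - Re (exp (\<i> * of_real (a * t) - w * of_real (t powr \<alpha>)))) / t\<^sup>2)"
proof -
  let ?e = "of_real (1 / t\<^sup>2) * exp (- (w * of_real (t powr \<alpha>)))"
  have "(\<lambda>n. (\<i> * of_real (a * t)) ^ n / fact n * ?e) sums (exp (\<i> * of_real (a * t)) * ?e)"
    using exp_converges[of "\<i> * of_real (a * t)"]
    by (intro sums_mult2) (simp add: scaleR_conv_of_real divide_inverse mult.commute)
  then have "(\<lambda>n. Re ((\<i> * of_real (a * t)) ^ n / fact n * ?e)) sums Re (exp (\<i> * of_real (a * t)) * ?e)"
    by (rule sums_Re)
  moreover have "(\<lambda>n. if n = 0 then 1 / t\<^sup>2 else 0) sums (1 / t\<^sup>2)"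
    using sums_single[of 0 "\<lambda>_. 1 / t\<^sup>2"] by simp
  ultimately have "(\<lambda>n. (if n = 0 then 1 / t\<^sup>2 else 0) - Re ((\<i> * of_real (a * t)) ^ n / fact n * ?e)) sums
      (1 / t\<^sup>2 - Re (exp (\<i> * of_real (a * t)) * ?e))"
    by (intro sums_diff)
  moreover have "(\<i> * of_real (a * t)) ^ n / fact n * ?e =
      (\<i> * of_real a) ^ n / fact n * (of_real (t powr (real n - 2)) * exp (- (w * of_real (t powr \<alpha>))))" for n
    using assms by (simp add: powr_diff powr_realpow powr_numeral power_mult_distrib)
  moreover have "1 / t\<^sup>2 - Re (exp (\<i> * of_real (a * t)) * ?e) =
      (1 - Re (exp (\<i> * of_real (a * t) - w * of_real (t powr \<alpha>)))) / t\<^sup>2"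
  proof -
    have "exp (\<i> * of_real (a * t)) * ?e = exp (\<i> * of_real (a * t) - w * of_real (t powr \<alpha>)) / of_real (t\<^sup>2)"
      by (simp add: exp_diff exp_minus divide_inverse)
    then show ?thesis
      by (simp only: Re_divide_of_real diff_divide_distrib)
  qed
  ultimately show ?thesis
    unfolding fourier_term_def by simp
qed

text \<open>One bound for all \<open>N\<close>, as dominated convergence needs. The two terms with
  exceptional behaviour at 0 are kept as they are, and the others are compared with the exponential
  series.\<close>

lemma sum_fourier_term_bound:
  assumes "0 < t"
  shows "\<bar>\<Sum>n<N. fourier_term \<alpha> w a n t\<bar> \<le>
    \<bar>fourier_term \<alpha> w a 0 t\<bar> + \<bar>fourier_term \<alpha> w a 1 t\<bar> + a\<^sup>2 * exp (\<bar>a\<bar> * t - Re w * t powr \<alpha>)"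
proof -
  have "\<bar>fourier_term \<alpha> w a (Suc (Suc k)) t\<bar> \<le> a\<^sup>2 * exp (- (Re w * t powr \<alpha>)) * ((\<bar>a\<bar> * t) ^ k /\<^sub>R fact k)" for k
  proof -
    have "\<bar>fourier_term \<alpha> w a (Suc (Suc k)) t\<bar> \<le>
      norm ((\<i> * of_real a) ^ Suc (Suc k) / fact (Suc (Suc k)) *
        (of_real (t powr (real (Suc (Suc k)) - 2)) * exp (- (w * of_real (t powr \<alpha>)))))"
      unfolding fourier_term_def using abs_Re_le_cmod by simp
    also have "\<dots> = \<bar>a\<bar> ^ Suc (Suc k) / fact (Suc (Suc k)) * (t ^ k * exp (- (Re w * t powr \<alpha>)))"
      using assms by (simp add: norm_mult norm_divide norm_power powr_realpow del: fact_Suc power_Suc)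
    \<comment> \<open>Giving up two factors of the factorial matches the power \<open>t ^ k\<close>
      and leads to the series of \<open>exp (\<bar>a\<bar> * t)\<close>.\<close>
    also have "\<dots> \<le> \<bar>a\<bar> ^ Suc (Suc k) / fact k * (t ^ k * exp (- (Re w * t powr \<alpha>)))"
      using assms fact_mono[of k "Suc (Suc k)", where 'a = real]
      by (intro mult_right_mono divide_left_mono) (auto simp del: fact_Suc)
    also have "\<dots> = a\<^sup>2 * exp (- (Re w * t powr \<alpha>)) * ((\<bar>a\<bar> * t) ^ k /\<^sub>R fact k)"
      by (simp add: power_mult_distrib power2_eq_square divide_inverse mult_ac)
    finally show ?thesis .
  qed
  then have "(\<Sum>k<N. \<bar>fourier_term \<alpha> w a (Suc (Suc k)) t\<bar>) \<le>
      (\<Sum>k<N. a\<^sup>2 * exp (- (Re w * t powr \<alpha>)) * ((\<bar>a\<bar> * t) ^ k /\<^sub>R fact k))"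
    by (intro sum_mono)
  also have "\<dots> = a\<^sup>2 * exp (- (Re w * t powr \<alpha>)) * (\<Sum>k<N. (\<bar>a\<bar> * t) ^ k /\<^sub>R fact k)"
    by (simp add: sum_distrib_left)
  also have "\<dots> \<le> a\<^sup>2 * exp (- (Re w * t powr \<alpha>)) * exp (\<bar>a\<bar> * t)"
  proof (rule mult_left_mono)
    show "(\<Sum>k<N. (\<bar>a\<bar> * t) ^ k /\<^sub>R fact k) \<le> exp (\<bar>a\<bar> * t)"
      unfolding exp_def using assms by (intro sum_le_suminf summable_exp_generic) auto
  qed simp
  also have "\<dots> = a\<^sup>2 * exp (\<bar>a\<bar> * t - Re w * t powr \<alpha>)"
    by (simp add: exp_diff exp_minus divide_inverse)
  finally have "(\<Sum>n<Suc (Suc N). \<bar>fourier_term \<alpha> w a n t\<bar>) \<le>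
      \<bar>fourier_term \<alpha> w a 0 t\<bar> + \<bar>fourier_term \<alpha> w a 1 t\<bar> + a\<^sup>2 * exp (\<bar>a\<bar> * t - Re w * t powr \<alpha>)"
    by (subst sum.lessThan_Suc_shift, subst sum.lessThan_Suc_shift) simp
  moreover have "\<bar>\<Sum>n<N. fourier_term \<alpha> w a n t\<bar> \<le> (\<Sum>n<Suc (Suc N). \<bar>fourier_term \<alpha> w a n t\<bar>)"
    by (rule order_trans[OF sum_abs]) (intro sum_mono2, auto)
  ultimately show ?thesis by linarith
qed

text \<open>Dominated convergence for the partial sums; the majorant is integrable because
  \<open>t powr \<alpha>\<close> outgrows \<open>\<bar>a\<bar> * t\<close>. Convergence of the
  integrals is at the same time summability of the coefficients.\<close>

lemma fourier_expansion:
  assumes "0 < Re w" "1 < \<alpha>"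
  shows "summable (fourier_coeff \<alpha> w a)"
    and "has_bochner_integral lborel_pos
      (\<lambda>t. (1 - Re (exp (\<i> * of_real (a * t) - w * of_real (t powr \<alpha>)))) / t\<^sup>2) (suminf (fourier_coeff \<alpha> w a))"
proof -
  let ?f = "\<lambda>t. (1 - Re (exp (\<i> * of_real (a * t) - w * of_real (t powr \<alpha>)))) / t\<^sup>2"
  let ?h = "\<lambda>t. \<bar>fourier_term \<alpha> w a 0 t\<bar> + \<bar>fourier_term \<alpha> w a 1 t\<bar> + a\<^sup>2 * exp (\<bar>a\<bar> * t - Re w * t powr \<alpha>)"
  have int: "integrable lborel_pos (fourier_term \<alpha> w a n)"
    "integral\<^sup>L lborel_pos (fourier_term \<alpha> w a n) = fourier_coeff \<alpha> w a n" for n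
    using has_bochner_integral_fourier_term[OF assms] by (auto simp: has_bochner_integral_iff)
  have meas: "?f \<in> borel_measurable lborel_pos"
    by (intro measurable_lborel_pos) measurable
  have sum_meas: "(\<lambda>t. \<Sum>n<N. fourier_term \<alpha> w a n t) \<in> borel_measurable lborel_pos" for N
    by (intro borel_measurable_sum borel_measurable_integrable int)
  have h: "integrable lborel_pos ?h"
    using assms by (intro Bochner_Integration.integrable_add integrable_abs integrable_mult_right
        integrable_exp_linear_minus_powr int) auto
  have lim: "AE t in lborel_pos. (\<lambda>N. \<Sum>n<N. fourier_term \<alpha> w a n t) \<longlonglongrightarrow> ?f t"
    by (rule AE_lborel_posI) (use fourier_term_sums in \<open>auto simp: sums_def\<close>)
  have bound: "AE t in lborel_pos. norm (\<Sum>n<N. fourier_term \<alpha> w a n t) \<le> ?h t" for N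
    unfolding real_norm_def by (rule AE_lborel_posI) (rule sum_fourier_term_bound)
  have "(\<lambda>N. \<integral>t. (\<Sum>n<N. fourier_term \<alpha> w a n t) \<partial>lborel_pos) \<longlonglongrightarrow> integral\<^sup>L lborel_pos ?f"
    by (rule integral_dominated_convergence[OF meas sum_meas h lim bound])
  then have "fourier_coeff \<alpha> w a sums integral\<^sup>L lborel_pos ?f"
    by (simp add: sums_def int)
  moreover have "integrable lborel_pos ?f"
    by (rule integrable_dominated_convergence[OF meas sum_meas h lim bound])
  ultimately show "summable (fourier_coeff \<alpha> w a)"
    "has_bochner_integral lborel_pos ?f (suminf (fourier_coeff \<alpha> w a))"
    by (auto simp: sums_iff has_bochner_integral_iff)
qed

section \<open>Closed form of the coefficients\<close>

text \<open>In polar form the phase of \<open>\<i> ^ n * w powr - z\<close> is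
  \<open>pi / 2 + pi * z\<close>, so the real part yields \<open>sin (pi * z)\<close>, and
  reflection turns \<open>Gamma z * sin (pi * z) / pi\<close> into \<open>rGamma (1 - z)\<close>. At
  \<open>n = 1\<close> the logarithmic coefficient contributes \<open>a / \<alpha> - a / 2\<close>,
  and the added \<open>a / 2\<close>, half the mean, completes it.\<close>

lemma fourier_coeff_eq:
  fixes \<alpha> c a :: real and n :: nat
  assumes "1 < \<alpha>" "\<alpha> \<le> 2" "0 < c"
  defines "w \<equiv> of_real c * cis (pi * (\<alpha> / 2 - 1))"
  shows "fourier_coeff \<alpha> w a n / pi + (if n = 1 then a / 2 else 0) =
    1 / \<alpha> * (1 / fact n * rGamma (1 + (1 - real n) / \<alpha>) * a ^ n * c powr ((1 - real n) / \<alpha>))"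
proof -
  define \<theta> where "\<theta> = pi * (\<alpha> / 2 - 1)"
  \<comment> \<open>The angle is in the principal range, so \<open>Ln\<close> returns it
    unchanged.\<close>
  have "- pi < \<theta>" "\<theta> \<le> pi"
  proof -
    have "pi * (- 1) < pi * (\<alpha> / 2 - 1)" "pi * (\<alpha> / 2 - 1) \<le> pi * 1"
      using assms by (intro mult_strict_left_mono mult_left_mono; simp)+
    then show "- pi < \<theta>" "\<theta> \<le> pi" by (simp_all add: \<theta>_def)
  qed
  then have "Ln (exp (of_real (ln c) + \<i> * of_real \<theta>)) = of_real (ln c) + \<i> * of_real \<theta>"
    by (intro Ln_exp) auto
  moreover have w: "w = exp (of_real (ln c) + \<i> * of_real \<theta>)"
    using assms by (simp add: w_def \<theta>_def exp_add cis_conv_exp exp_of_real)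
  ultimately have Ln_w: "Ln w = of_real (ln c) + \<i> * of_real \<theta>" by simp
  have "w \<noteq> 0" using w by simp
  show ?thesis
  proof (cases "n = 1")
    case True
    have Im_Ln: "Im (Ln w) = pi * (\<alpha> / 2 - 1)"
      unfolding Ln_w by (simp add: \<theta>_def)
    show ?thesis
      unfolding fourier_coeff_def Im_Ln using True assms(1,3) by (simp add: field_simps)
  next
    case False
    define z where "z = (real n - 1) / \<alpha>"
    have "w powr - of_real z = of_real (c powr - z) * cis (- (z * \<theta>))"
      using \<open>w \<noteq> 0\<close> assms(3)
      by (simp add: powr_def Ln_w cis_conv_exp exp_of_real[symmetric] exp_add[symmetric] algebra_simps)
    then have "(\<i> * of_real a) ^ n / fact n * (of_real (Gamma z / \<alpha>) * w powr - of_real z) =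
       of_real (a ^ n / fact n * (Gamma z / \<alpha>) * c powr - z) * (\<i> ^ n * cis (- (z * \<theta>)))"
      by (simp add: power_mult_distrib)
    also have "\<i> ^ n * cis (- (z * \<theta>)) = cis (real n * (pi / 2) - z * \<theta>)"
    proof -
      have "\<i> ^ n = cis (real n * (pi / 2))"
        by (rule Complex.DeMoivre[of "pi / 2" n, unfolded cis_pi_half])
      then show ?thesis by (simp only: cis_mult diff_conv_add_uminus)
    qed
    also have "real n * (pi / 2) - z * \<theta> = pi / 2 + pi * z"
      using assms by (simp add: z_def \<theta>_def field_simps)
    finally have "Re ((\<i> * of_real a) ^ n / fact n * (of_real (Gamma z / \<alpha>) * w powr - of_real z)) =
        a ^ n / fact n * (Gamma z / \<alpha>) * c powr - z * cos (pi / 2 + pi * z)"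
      by (simp only: times_complex.sel Re_complex_of_real Im_complex_of_real cis.sel mult_zero_left diff_zero)
    then have "fourier_coeff \<alpha> w a n = a ^ n / fact n * (Gamma z / \<alpha>) * c powr - z * sin (pi * z)"
      using False by (simp only: fourier_coeff_def z_def[symmetric] cos_add) simp
    \<comment> \<open>Only \<open>z\<close> must avoid the poles. If \<open>1 - z\<close> is a pole,
      then \<open>z\<close> is a positive integer and both sides vanish.\<close>
    moreover have "rGamma (1 - z) = sin (pi * z) * Gamma z / pi"
    proof -
      have "z \<notin> \<int>\<^sub>\<le>\<^sub>0"
      proof (cases "n = 0")
        case True
        then have "- 1 < z" "z < 0" using assms by (auto simp: z_def)
        then show ?thesis by (auto elim!: nonpos_Ints_cases)
      next
        case False
        with \<open>n \<noteq> 1\<close> have "0 < z" using assms by (simp add: z_def)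
        then show ?thesis by (auto elim!: nonpos_Ints_cases)
      qed
      then have "rGamma z \<noteq> 0" by (simp add: rGamma_eq_zero_iff)
      have "complex_of_real (rGamma z * rGamma (1 - z)) = of_real (sin (pi * z) / pi)"
        using rGamma_reflection_complex[of "of_real z"]
        by (simp add: rGamma_complex_of_real[symmetric] sin_of_real[symmetric])
      then have "rGamma z * rGamma (1 - z) = sin (pi * z) / pi"
        unfolding of_real_eq_iff .
      then show ?thesis using \<open>rGamma z \<noteq> 0\<close> by (simp add: Gamma_def field_simps)
    qed
    moreover have "1 + (1 - real n) / \<alpha> = 1 - z" "(1 - real n) / \<alpha> = - z"
      by (simp_all add: z_def diff_divide_distrib)
    ultimately show ?thesis
      using False by (simp add: mult_ac)
  qed
qed

section \<open>The stable case\<close>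

text \<open>The quotient splits into that of \<open>exp (- w * h powr \<alpha>)\<close>, of order
  \<open>h powr (\<alpha> - 1)\<close> and hence vanishing, and that of
  \<open>exp (\<i> * h * a)\<close> times a factor tending to 1.\<close>

lemma difference_quotient_exp_powr_tendsto:
  fixes \<alpha> a :: real and w :: complex
  assumes "1 < \<alpha>" "0 < Re w"
  shows "((\<lambda>h. (exp (\<i> * of_real (h * a) - w * of_real (h powr \<alpha>)) - 1) / of_real h) \<longlongrightarrow> \<i> * of_real a) (at_right 0)"
proof -
  have exp_quot: "((\<lambda>x. (exp x - 1) / x) \<longlongrightarrow> 1) (at (0 :: complex))"
    using DERIV_exp[of "0 :: complex"] by (simp add: DERIV_def)
  have powr_0: "((\<lambda>h. - w * of_real (h powr \<beta>)) \<longlongrightarrow> 0) (at_right 0)" if "0 < \<beta>" for \<beta>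
  proof -
    have "\<forall>\<^sub>F h in at_right 0. 0 \<le> (h :: real)"
      using eventually_at_right_less[of "0 :: real"] by (rule eventually_mono) simp
    then have "((\<lambda>h::real. h powr \<beta>) \<longlongrightarrow> 0 powr \<beta>) (at_right 0)"
      using that by (intro tendsto_powr' tendsto_intros) auto
    from tendsto_mult[OF tendsto_const tendsto_of_real[OF this], of "- w"] show ?thesis by simp
  qed
  have "w \<noteq> 0" using assms by auto
  have "filterlim (\<lambda>h. - w * of_real (h powr \<alpha>)) (at 0) (at_right 0)"
    using powr_0[of \<alpha>] assms \<open>w \<noteq> 0\<close> by (auto simp: filterlim_at eventually_at_filter)
  from filterlim_compose[OF exp_quot this]
  have "((\<lambda>h. (exp (- w * of_real (h powr \<alpha>)) - 1) / (- w * of_real (h powr \<alpha>)) * (- w * of_real (h powr (\<alpha> - 1)))) \<longlongrightarrow> 1 * 0) (at_right 0)"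
    using assms by (intro tendsto_mult powr_0) auto
  moreover have "((\<lambda>h. (exp (\<i> * (of_real h * of_real a)) - 1) / of_real h * exp (- w * of_real (h powr \<alpha>))) \<longlongrightarrow> \<i> * of_real a * exp 0) (at_right 0)"
  proof (intro tendsto_mult tendsto_exp powr_0)
    have "((\<lambda>h. exp (\<i> * (h * of_real a))) has_field_derivative \<i> * of_real a) (at (0 :: complex))"
      by (auto intro!: derivative_eq_intros)
    then have "((\<lambda>h. (exp (\<i> * (h * of_real a)) - 1) / h) \<longlongrightarrow> \<i> * of_real a) (at (0 :: complex))"
      by (simp add: DERIV_def)
    moreover have "filterlim (complex_of_real) (at 0) (at_right 0)"
      by (auto simp: filterlim_at eventually_at_filter intro!: tendsto_eq_intros)
    ultimately show "((\<lambda>h. (exp (\<i> * (of_real h * of_real a)) - 1) / of_real h) \<longlongrightarrow> \<i> * of_real a) (at_right 0)"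
      by (rule filterlim_compose)
  qed (use assms in auto)
  ultimately have "((\<lambda>h. (exp (- w * of_real (h powr \<alpha>)) - 1) / (- w * of_real (h powr \<alpha>)) * (- w * of_real (h powr (\<alpha> - 1))) +
      (exp (\<i> * (of_real h * of_real a)) - 1) / of_real h * exp (- w * of_real (h powr \<alpha>))) \<longlongrightarrow> 1 * 0 + \<i> * of_real a * exp 0) (at_right 0)"
    by (intro tendsto_add)
  moreover have "\<forall>\<^sub>F h in at_right 0. (exp (- w * of_real (h powr \<alpha>)) - 1) / (- w * of_real (h powr \<alpha>)) * (- w * of_real (h powr (\<alpha> - 1))) +
      (exp (\<i> * (of_real h * of_real a)) - 1) / of_real h * exp (- w * of_real (h powr \<alpha>)) =
      (exp (\<i> * of_real (h * a) - w * of_real (h powr \<alpha>)) - 1) / of_real h"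
    using eventually_at_right_less[of "0 :: real"]
  proof eventually_elim
    case (elim h)
    have "(exp (- w * of_real (h powr \<alpha>)) - 1) / (- w * of_real (h powr \<alpha>)) * (- w * of_real (h powr (\<alpha> - 1)))
        = (exp (- w * of_real (h powr \<alpha>)) - 1) / of_real h"
      using elim \<open>w \<noteq> 0\<close> by (simp add: powr_diff field_simps)
    moreover have "exp (\<i> * of_real (h * a) - w * of_real (h powr \<alpha>)) = exp (\<i> * (of_real h * of_real a)) * exp (- w * of_real (h powr \<alpha>))"
      by (simp add: exp_add[symmetric])
    ultimately show ?case
      by (simp only: diff_divide_distrib left_diff_distrib times_divide_eq_left) simp
  qed
  ultimately show ?thesis
    by (subst (asm) tendsto_cong) (assumption, simp)
qed

text \<open>The absolute moment comes first, since its finiteness is what allows the mean to be read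
  off the difference quotients. Both arguments sample \<open>char M\<close> at positive points, so
  its form is prescribed only there.\<close>

lemma (in real_distribution) expectation_positive_part:
  fixes \<alpha> a :: real and w :: complex
  assumes "1 < \<alpha>" "0 < Re w"
    and char: "\<And>t. 0 < t \<Longrightarrow> char M t = exp (\<i> * of_real (t * a) - w * of_real (t powr \<alpha>))"
  shows "summable (fourier_coeff \<alpha> w a)"
    and "has_bochner_integral M positive_part (suminf (fourier_coeff \<alpha> w a) / pi + a / 2)"
proof -
  let ?V = "suminf (fourier_coeff \<alpha> w a)"
  show "summable (fourier_coeff \<alpha> w a)"
    by (rule fourier_expansion(1)[OF assms(2,1)])
  have "has_bochner_integral lborel_pos (\<lambda>t. (1 - Re (char M t)) / t\<^sup>2) ?V"
    using fourier_expansion(2)[OF assms(2,1), of a]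
    by (rule has_bochner_integral_cong[THEN iffD1, rotated -1])
      (auto simp: space_restrict_space char mult.commute)
  then have abs: "has_bochner_integral M (\<lambda>x. \<bar>x\<bar>) (2 / pi * ?V)"
    by (rule has_bochner_integral_abs_char)
  then have "integrable M (\<lambda>x. x)"
    by (auto simp: has_bochner_integral_iff integrable_abs_iff)
  then have "(\<lambda>n. (char M (1 / real (Suc n)) - 1) * real (Suc n)) \<longlonglongrightarrow> \<i> * expectation (\<lambda>x. x)"
    by (rule char_difference_quotient_tendsto)
  moreover have "filterlim (\<lambda>n. 1 / real (Suc n)) (at_right 0) sequentially"
    using LIMSEQ_Suc[OF lim_1_over_n[where 'a = real]] by (auto simp: filterlim_at simp del: of_nat_Suc)
  from filterlim_compose[OF difference_quotient_exp_powr_tendsto[OF assms(1,2)] this]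
  have "(\<lambda>n. (char M (1 / real (Suc n)) - 1) * real (Suc n)) \<longlonglongrightarrow> \<i> * of_real a"
    by (simp add: char del: of_nat_Suc)
  ultimately have "\<i> * of_real (expectation (\<lambda>x. x)) = \<i> * complex_of_real a"
    by (rule LIMSEQ_unique)
  then have "has_bochner_integral M (\<lambda>x. x) a"
    using \<open>integrable M (\<lambda>x. x)\<close> by (simp add: has_bochner_integral_iff)
  from has_bochner_integral_divide_zero[OF has_bochner_integral_add[OF abs this], of 2]
  have "has_bochner_integral M (\<lambda>x. (\<bar>x\<bar> + x) / 2) ((2 / pi * ?V + a) / 2)" .
  moreover have "(\<lambda>x. (\<bar>x\<bar> + x) / 2) = positive_part"
    by (auto simp: positive_part_def split: split_indicator)
  ultimately show "has_bochner_integral M positive_part (?V / pi + a / 2)"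
    by (simp add: add_divide_distrib)
qed

section \<open>Reduction of the option value to a shifted stable law\<close>

lemma (in prob_space) char_distr_shift:
  assumes "random_variable borel Y"
  shows "char (distr M borel (\<lambda>\<omega>. Y \<omega> + a)) t = iexp (t * a) * char (distr M borel Y) t"
proof -
  have "iexp (t * (Y \<omega> + a)) = iexp (t * a) * iexp (t * Y \<omega>)" for \<omega>
    by (simp add: exp_add[symmetric] algebra_simps)
  then show ?thesis
    using assms by (simp add: char_def integral_distr)
qed

text \<open>The price is an exponential, so the logarithm is affine in \<open>x\<close>;
  \<open>u > 0\<close> can be pulled out of \<open>positive_part\<close>.\<close>

lemma log_power_call_payoff_asset_price:
  assumes "0 < u" "0 < S" "0 < K"
  shows "log_power_call_payoff u (asset_price S r \<mu> \<tau> x) K =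
    u * positive_part (x + (ln (S / K powr (1 / u)) + r * \<tau> + \<mu> * \<tau>))"
proof -
  have "ln (asset_price S r \<mu> \<tau> x powr u / K) = u * (ln S + ((r + \<mu>) * \<tau> + x)) - ln K"
    using assms by (simp add: asset_price_def ln_div ln_powr ln_mult)
  also have "\<dots> = u * (x + (ln (S / K powr (1 / u)) + r * \<tau> + \<mu> * \<tau>))"
    using assms by (simp add: ln_div ln_powr field_simps)
  finally show ?thesis
    using assms by (simp add: log_power_call_payoff_def positive_part_def zero_less_mult_iff indicator_def)
qed

text \<open>The Bochner integral and \<open>suminf\<close> are total functions, so integrability of
  the payoff and convergence of the series are asserted along with the price. \<open>rGamma\<close>
  is 0 at the poles of Gamma, in line with the convention on its reciprocal.\<close>

theorem proposition3:
  fixes M :: "'a measure" and X :: "real \<Rightarrow> 'a \<Rightarrow> real"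
    and \<alpha> \<sigma> u S K r \<tau> \<mu> k\<^sub>u :: real
  assumes "1 < \<alpha>" and "\<alpha> \<le> 2" and "0 < \<sigma>" and "0 < u" and "0 < S" and "0 < K" and "0 < \<tau>"
    and "spectrally_negative_stable_process M X \<alpha> \<sigma>"
    and "\<mu> = \<sigma> powr \<alpha> / cos (pi * \<alpha> / 2)"
    and "k\<^sub>u = ln (S / K powr (1 / u)) + r * \<tau>"
  shows "integrable M (\<lambda>\<omega>. log_power_call_payoff u (asset_price S r \<mu> \<tau> (X \<tau> \<omega>)) K) \<and>
    summable (\<lambda>n. 1 / fact n * rGamma (1 + (1 - real n) / \<alpha>) *
      (k\<^sub>u + \<mu> * \<tau>) ^ n * (- \<mu> * \<tau>) powr ((1 - real n) / \<alpha>)) \<and>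
    option_value M X (log_power_call_payoff u) S K r \<mu> \<tau> =
      u * exp (- r * \<tau>) / \<alpha> *
      (\<Sum>n. 1 / fact n * rGamma (1 + (1 - real n) / \<alpha>) *
        (k\<^sub>u + \<mu> * \<tau>) ^ n * (- \<mu> * \<tau>) powr ((1 - real n) / \<alpha>))"
proof -
  interpret spectrally_negative_stable_process M X \<alpha> \<sigma> by fact
  define a where "a = k\<^sub>u + \<mu> * \<tau>"
  define c where "c = - \<mu> * \<tau>"
  define w where "w = of_real c * cis (pi * (\<alpha> / 2 - 1))"
  define s where "s = (\<lambda>n. 1 / fact n * rGamma (1 + (1 - real n) / \<alpha>) * a ^ n * c powr ((1 - real n) / \<alpha>))"
  have X[measurable]: "random_variable borel (X \<tau>)"
    using \<open>0 < \<tau>\<close> by (intro random_variable_X) simp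
  have angle: "pi / 2 < pi * \<alpha> / 2" "pi * \<alpha> / 2 \<le> pi" using assms by simp_all
  \<comment> \<open>This makes \<open>\<mu>\<close> negative and so \<open>c\<close>, the modulus of
    \<open>w\<close>, positive.\<close>
  have cos_neg: "cos (pi * \<alpha> / 2) < 0"
    using cos_monotone_0_pi[of "pi / 2" "pi * \<alpha> / 2"] angle by simp
  then have "0 < c"
    using assms by (simp add: c_def divide_pos_neg mult_neg_pos)
  have c_cos: "c * cos (pi * \<alpha> / 2) = - (\<tau> * \<sigma> powr \<alpha>)"
    using cos_neg by (simp add: c_def assms(9))
  \<comment> \<open>The right-hand side is the factor of \<open>- (t powr \<alpha>)\<close> in the
    exponent of the characteristic function at \<open>t > 0\<close>; the polar form on the left is
    the one \<open>fourier_coeff_eq\<close> works with. Shifting the angle by \<open>pi\<close>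
    flips the signs of \<open>cos\<close> and \<open>sin\<close>, which compensates
    \<open>cos (pi * \<alpha> / 2) < 0\<close>.\<close>
  have w: "w = of_real (\<tau> * \<sigma> powr \<alpha>) * (1 + \<i> * of_real (tan (\<alpha> * pi / 2)))"
  proof (rule complex_eqI)
    have *: "pi * (\<alpha> / 2 - 1) = pi * \<alpha> / 2 - pi" by (simp add: algebra_simps)
    show "Re w = Re (of_real (\<tau> * \<sigma> powr \<alpha>) * (1 + \<i> * of_real (tan (\<alpha> * pi / 2))))"
      using c_cos by (simp add: w_def *)
    have "c * sin (pi * \<alpha> / 2) = - (\<tau> * \<sigma> powr \<alpha>) * tan (pi * \<alpha> / 2)"
      unfolding c_cos[symmetric] tan_def using cos_neg by simp
    then show "Im w = Im (of_real (\<tau> * \<sigma> powr \<alpha>) * (1 + \<i> * of_real (tan (\<alpha> * pi / 2))))"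
      by (simp add: w_def * mult.commute[of \<alpha> pi])
  qed
  then have "0 < Re w" using assms by simp
  define L where "L = distr M borel (\<lambda>\<omega>. X \<tau> \<omega> + a)"
  interpret L: real_distribution L
    unfolding L_def by (rule real_distribution_distr) simp
  have char_L: "char L t = exp (\<i> * of_real (t * a) - w * of_real (t powr \<alpha>))" if "0 < t" for t
  proof -
    have "char L t = iexp (t * a) * char (distr M borel (X \<tau>)) t"
      unfolding L_def by (rule char_distr_shift) simp
    then show ?thesis
      using that \<open>0 < \<tau>\<close> by (simp add: char_X w exp_add[symmetric] algebra_simps)
  qed
  note series = L.expectation_positive_part[OF \<open>1 < \<alpha>\<close> \<open>0 < Re w\<close> char_L]
  have s_eq: "fourier_coeff \<alpha> w a n / pi + (if n = 1 then a / 2 else 0) = 1 / \<alpha> * s n" for n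
    unfolding w_def s_def by (rule fourier_coeff_eq) (use assms \<open>0 < c\<close> in auto)
  \<comment> \<open>Half the mean is absorbed into the term \<open>n = 1\<close>, where the closed
    form of the coefficients expects it.\<close>
  have "(\<lambda>n. fourier_coeff \<alpha> w a n / pi + (if n = 1 then a / 2 else 0)) sums
      (suminf (fourier_coeff \<alpha> w a) / pi + a / 2)"
    using series(1) sums_single[of 1 "\<lambda>_. a / 2"]
    by (intro sums_add sums_divide) (auto simp: summable_sums)
  then have "(\<lambda>n. \<alpha> * (1 / \<alpha> * s n)) sums (\<alpha> * (suminf (fourier_coeff \<alpha> w a) / pi + a / 2))"
    unfolding s_eq by (rule sums_mult)
  then have s: "s sums (\<alpha> * (suminf (fourier_coeff \<alpha> w a) / pi + a / 2))"
    using assms by simp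
  have payoff: "log_power_call_payoff u (asset_price S r \<mu> \<tau> x) K = u * positive_part (x + a)" for x
    using log_power_call_payoff_asset_price[OF assms(4-6)] by (simp add: a_def assms(10))
  have "has_bochner_integral M (\<lambda>\<omega>. positive_part (X \<tau> \<omega> + a)) (suminf s / \<alpha>)"
  proof -
    have "positive_part \<in> borel_measurable borel"
      unfolding positive_part_def by measurable
    then have "integrable L positive_part \<longleftrightarrow> integrable M (\<lambda>\<omega>. positive_part (X \<tau> \<omega> + a))"
      "integral\<^sup>L L positive_part = (\<integral>\<omega>. positive_part (X \<tau> \<omega> + a) \<partial>M)"
      unfolding L_def by (intro integrable_distr_eq integral_distr; simp)+
    moreover have "suminf s / \<alpha> = suminf (fourier_coeff \<alpha> w a) / pi + a / 2"
      using s \<open>1 < \<alpha>\<close> by (simp add: sums_iff)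
    ultimately show ?thesis
      using series(2) by (simp add: has_bochner_integral_iff)
  qed
  then have "has_bochner_integral M (\<lambda>\<omega>. u * positive_part (X \<tau> \<omega> + a)) (u * (suminf s / \<alpha>))"
    by (rule has_bochner_integral_mult_right)
  then show ?thesis
    using s unfolding option_value_def payoff a_def[symmetric] c_def[symmetric] s_def[symmetric]
    by (auto simp: has_bochner_integral_iff sums_iff)
qed

end
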